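(* Let $d=2$ or $d=3$ and $T>0$. Let $f:[0,T]\times\mathbb R^{d-1}\to\mathbb R$ be a classical subsolution and $g:[0,T]\times\mathbb R^{d-1}\to\mathbb R$ a classical supersolution of the $d$-dimensional Muskat equation $$\partial_t f(t,x)=\mathrm{P.V.}\int_{\mathbb R^{d-1}}\frac{f(t,y)-f(t,x)-\nabla_xf(t,x)\cdot(y-x)}{\big((f(t,y)-f(t,x))^2+|y-x|^2\big)^{d/2}}\,dy .$$ Assume $\|\nabla_xf\|_{L^\infty},\|\nabla_xg\|_{L^\infty}<\frac1{\sqrt{2d-1}}$ (suprema over all times and points) and $f(0,x)\le g(0,x)$ for all $x$. Then $f(t,x)\le g(t,x)$ for all $t\in[0,T]$ and $x\in\mathbb R^{d-1}$.
   Context: $f:[0,T]\times\mathbb R^{d-1}\to\mathbb R$ is a classical solution of the $d$-dimensional Muskat equation if (1) $f\in C^1((0,T)\times\mathbb R^{d-1})$ and $\|f(\epsilon,\cdot)-f(0,\cdot)\|_{L^\infty}\to0$, $\|f(T,\cdot)-f(T-\epsilon,\cdot)\|_{L^\infty}\to 0$ as $\epsilon\to0+$; (2) for every compact $\mathcal K\subseteq(0,T)\times\mathbb R^{d-1}$ there are smooth nonnegative functions $\omega,\Omega:[0,\infty)\to[0,\infty)$ with $\sup_{(t,x)\in\mathcal K}\sup_{h\in B_r}|f(t,x+h)-f(t,x)-\nabla_xf(t,x)\cdot h|\le\omega(r)r$, $\sup_{(t,x)\in\mathcal K}\sup_{h\in B_R}|f(t,x+h)-f(t,x)|\le\Omega(R)$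 and $\int_0^1\frac{\omega(r)}{r}dr+\int_1^\infty\frac{\Omega(R)}{R^2}dR<\infty$; (3) the equation holds at every $(t,x)\in(0,T)\times\mathbb R^{d-1}$, the integral being taken in the principal value sense around $y=x$ and $\infty$. A classical subsolution (respectively supersolution) is defined in the same way with the equality "$=$" in the equation in (3) replaced by "$\le$" (respectively "$\ge$"). *)

theory Defs
  imports "HOL-Analysis.Analysis"
begin

definition grad :: "('a::real_inner \<Rightarrow> real) \<Rightarrow> 'a \<Rightarrow> 'a" where
  "grad u x = (THE D. GDERIV u x :> D)"

definition C1_on :: "'a::real_normed_vector set \<Rightarrow> ('a \<Rightarrow> 'b::real_normed_vector) \<Rightarrow> bool" where
  "C1_on S F \<longleftrightarrow> (\<exists>F' :: 'a \<Rightarrow> 'a \<Rightarrow>\<^sub>L 'b.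
     (\<forall>z\<in>S. (F has_derivative blinfun_apply (F' z)) (at z)) \<and> continuous_on S F')"

(* A sequence of successive derivatives relative to S; at an end point of an
   interval S these are one-sided. *)
definition smooth_within :: "real set \<Rightarrow> (real \<Rightarrow> real) \<Rightarrow> bool" where
  "smooth_within S w \<longleftrightarrow> (\<exists>D :: nat \<Rightarrow> real \<Rightarrow> real.
     (\<forall>r\<in>S. D 0 r = w r) \<and>
     (\<forall>k. \<forall>r\<in>S. (D k has_real_derivative D (Suc k) r) (at r within S)))"

(* The supremum over S, not the essential supremum, with value \<infinity> for unbounded u. *)
definition sup_norm_on :: "'a set \<Rightarrow> ('a \<Rightarrow> 'b::real_normed_vector) \<Rightarrow> ereal" where
  "sup_norm_on S u = (SUP z\<in>S. ereal (norm (u z)))"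

(* Principal value around both x and \<infinity>: the integrals over the annuli
   a \<le> |y - x| \<le> b converge to I as a \<rightarrow> 0+ and b \<rightarrow> \<infinity> independently. *)
definition has_pv_integral ::
  "('a::euclidean_space \<Rightarrow> real) \<Rightarrow> 'a \<Rightarrow> real \<Rightarrow> bool" where
  "has_pv_integral u x I \<longleftrightarrow>
     (\<forall>a b. 0 < a \<and> a < b \<longrightarrow> set_integrable lborel {y. a \<le> dist x y \<and> dist x y \<le> b} u) \<and>
     ((\<lambda>(a, b). set_lebesgue_integral lborel {y. a \<le> dist x y \<and> dist x y \<le> b} u)
        \<longlongrightarrow> I) (at_right 0 \<times>\<^sub>F at_top)"

(* The dimension d of the paper is CARD('n) + 1. *)
definition muskat_integrand :: "(real^'n \<Rightarrow> real) \<Rightarrow> real^'n \<Rightarrow> real^'n \<Rightarrow> real" where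
  "muskat_integrand u x y =
     (u y - u x - grad u x \<bullet> (y - x)) /
     ((u y - u x)\<^sup>2 + (norm (y - x))\<^sup>2) powr (real (CARD('n) + 1) / 2)"

(* Functions on [0,T] \<times> R^(d-1) are total functions of type real \<Rightarrow> real^'n \<Rightarrow> real whose
   values at times outside [0,T] are irrelevant.  The argument rel is (=) for classical
   solutions, (\<le>) for subsolutions and (\<ge>) for supersolutions. *)
definition muskat_classical ::
  "(real \<Rightarrow> real \<Rightarrow> bool) \<Rightarrow> real \<Rightarrow> (real \<Rightarrow> real^'n \<Rightarrow> real) \<Rightarrow> bool" where
  "muskat_classical rel T f \<longleftrightarrow>
     C1_on ({0<..<T} \<times> UNIV) (\<lambda>(t, x). f t x) \<and>
     ((\<lambda>e. sup_norm_on UNIV (\<lambda>x. f e x - f 0 x)) \<longlongrightarrow> 0) (at_right 0) \<and>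
     ((\<lambda>e. sup_norm_on UNIV (\<lambda>x. f T x - f (T - e) x)) \<longlongrightarrow> 0) (at_right 0) \<and>
     (\<forall>K. compact K \<and> K \<subseteq> {0<..<T} \<times> UNIV \<longrightarrow>
        (\<exists>\<omega> \<Omega> :: real \<Rightarrow> real.
           smooth_within {0..} \<omega> \<and> smooth_within {0..} \<Omega> \<and>
           (\<forall>r\<ge>0. 0 \<le> \<omega> r) \<and> (\<forall>r\<ge>0. 0 \<le> \<Omega> r) \<and>
           (\<forall>r\<ge>0. \<forall>(t, x)\<in>K. \<forall>h\<in>ball 0 r.
              \<bar>f t (x + h) - f t x - grad (f t) x \<bullet> h\<bar> \<le> \<omega> r * r) \<and>
           (\<forall>R\<ge>0. \<forall>(t, x)\<in>K. \<forall>h\<in>ball 0 R. \<bar>f t (x + h) - f t x\<bar> \<le> \<Omega> R) \<and>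
           (\<integral>\<^sup>+r\<in>{0<..1}. ennreal (\<omega> r / r) \<partial>lborel)
             + (\<integral>\<^sup>+R\<in>{1..}. ennreal (\<Omega> R / R\<^sup>2) \<partial>lborel) < \<infinity>)) \<and>
     (\<forall>t\<in>{0<..<T}. \<forall>x. \<exists>I.
        has_pv_integral (muskat_integrand (f t) x) x I \<and> rel (deriv (\<lambda>s. f s x) t) I)"

definition classical_muskat_subsolution :: "real \<Rightarrow> (real \<Rightarrow> real^'n \<Rightarrow> real) \<Rightarrow> bool" where
  "classical_muskat_subsolution = muskat_classical (\<le>)"

definition classical_muskat_supersolution :: "real \<Rightarrow> (real \<Rightarrow> real^'n \<Rightarrow> real) \<Rightarrow> bool" where
  "classical_muskat_supersolution = muskat_classical (\<ge>)"

end

theory Submission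
  imports Defs
begin

text \<open>
  Doubling the space variable, one maximises
  \<open>f t x - g t y - k \<bar>x - y\<bar>\<^sup>2 - \<epsilon> exp (\<mu> (t - a)) \<langle>x\<rangle> - 1 / k - \<kappa> (t - a) - \<eta>\<close>
  over a slab \<open>a \<le> t \<le> b\<close>; the moduli \<open>\<Omega>\<close> make \<open>f\<close> and \<open>g\<close> sublinear, so a positive
  supremum is attained.  At the maximum the quadratic term makes \<open>f\<close> semiconcave and \<open>g\<close>
  semiconvex at the touching points with constants depending only on \<open>k\<close>, so the moduli \<open>\<omega>\<close>,
  which depend on the unknown location of the maximum, are never needed.  The slope bound
  \<open>(2 d - 1) L\<^sup>2 < 1\<close> is what makes \<open>(s - v \<bullet> h) / (s\<^sup>2 + \<bar>h\<bar>\<^sup>2) powr (d / 2)\<close> nondecreasing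
  in \<open>s\<close>, so the two principal values differ by at most
  \<open>\<mu> \<epsilon> exp (\<mu> (t - a)) \<langle>x\<rangle> + \<kappa> / 2\<close> for suitable \<open>\<mu>\<close>, less than the time derivative of
  the penalty.  Then \<open>\<epsilon>\<close>, \<open>\<kappa>\<close>, \<open>1 / k\<close> and \<open>a\<close> tend to zero, in this order.
\<close>

subsection \<open>The Muskat kernel\<close>

text \<open>The singular integrand along a displacement \<open>h\<close>: \<open>r\<close> stands
  for its length, \<open>s\<close> for the increment of the function and \<open>m\<close> for the
  gradient paired with \<open>h\<close>. Freezing \<open>r\<close> and \<open>m\<close> turns the
  comparison of integrands into one-variable calculus in \<open>s\<close>.\<close>

definition kern :: "real \<Rightarrow> real \<Rightarrow> real \<Rightarrow> real \<Rightarrow> real" where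
  "kern d r s m = (s - m) / (s\<^sup>2 + r\<^sup>2) powr (d / 2)"

lemma kern_alt: "kern d r s m = (s - m) * (s\<^sup>2 + r\<^sup>2) powr (- (d / 2))"
  by (simp add: kern_def powr_minus_divide)

lemma DERIV_weight:
  fixes r :: real
  assumes "r > 0"
  shows "((\<lambda>s. (s\<^sup>2 + r\<^sup>2) powr (- (d / 2))) has_real_derivative
           - (d * s * (s\<^sup>2 + r\<^sup>2) powr (- (d / 2) - 1))) (at s)"
proof -
  have pos: "s\<^sup>2 + r\<^sup>2 > 0"
    using assms by (simp add: add_nonneg_pos)
  have "((\<lambda>s. s\<^sup>2 + r\<^sup>2) has_real_derivative 2 * s) (at s)"
    by (auto intro!: derivative_eq_intros)
  from DERIV_fun_powr[OF this pos, of "- (d / 2)"] show ?thesis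
    by (rule DERIV_cong) simp
qed

lemma weight_lipschitz:
  fixes r d s s' :: real
  assumes r: "r > 0" and d: "d \<ge> 0"
  shows "\<bar>(s\<^sup>2 + r\<^sup>2) powr (- (d / 2)) - (s'\<^sup>2 + r\<^sup>2) powr (- (d / 2))\<bar>
           \<le> d * r powr (- d - 1) * \<bar>s - s'\<bar>"
proof -
  have "norm ((s\<^sup>2 + r\<^sup>2) powr (- (d / 2)) - (s'\<^sup>2 + r\<^sup>2) powr (- (d / 2)))
           \<le> d * r powr (- d - 1) * norm (s - s')"
  proof (rule field_differentiable_bound[where S = UNIV
        and f' = "\<lambda>s. - (d * s * (s\<^sup>2 + r\<^sup>2) powr (- (d / 2) - 1))"])
    fix z :: real
    show "((\<lambda>s. (s\<^sup>2 + r\<^sup>2) powr (- (d / 2))) has_real_derivative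
           - (d * z * (z\<^sup>2 + r\<^sup>2) powr (- (d / 2) - 1))) (at z within UNIV)"
      using DERIV_weight[OF r] by simp
    have pos: "z\<^sup>2 + r\<^sup>2 > 0"
      using r by (simp add: add_nonneg_pos)
    \<comment> \<open>One factor \<open>z\<close> is absorbed as half a power of
      \<open>z^2 + r^2\<close>; the exponent that remains is negative, so dropping
      \<open>z^2\<close> only enlarges the bound.\<close>
    have "\<bar>z\<bar> \<le> (z\<^sup>2 + r\<^sup>2) powr (1 / 2)"
      using pos by (simp add: powr_half_sqrt real_le_rsqrt)
    then have "\<bar>z\<bar> * (z\<^sup>2 + r\<^sup>2) powr (- (d / 2) - 1)
        \<le> (z\<^sup>2 + r\<^sup>2) powr (1 / 2) * (z\<^sup>2 + r\<^sup>2) powr (- (d / 2) - 1)"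
      by (rule mult_right_mono) simp
    also have "\<dots> = (z\<^sup>2 + r\<^sup>2) powr (- (d + 1) / 2)"
      by (simp only: powr_add[symmetric]) (rule arg_cong[where f = "\<lambda>x. _ powr x"], simp add: field_simps)
    also have "\<dots> \<le> (r\<^sup>2) powr (- (d + 1) / 2)"
      using r d by (intro powr_mono2') auto
    also have "(r\<^sup>2) powr (- (d + 1) / 2) = r powr (- d - 1)"
    proof -
      have "(r\<^sup>2) powr (- (d + 1) / 2) = (r powr 2) powr (- (d + 1) / 2)"
        using r by simp
      also have "\<dots> = r powr (- d - 1)"
        by (simp only: powr_powr) (rule arg_cong[where f = "\<lambda>x. _ powr x"], simp add: field_simps)
      finally show ?thesis .
    qed
    finally show "norm (- (d * z * (z\<^sup>2 + r\<^sup>2) powr (- (d / 2) - 1))) \<le> d * r powr (- d - 1)"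
      using d by (simp add: abs_mult mult.assoc mult_left_mono)
  qed auto
  then show ?thesis by simp
qed

lemma weight_le:
  fixes r d s :: real
  assumes r: "r > 0" and d: "d \<ge> 0"
  shows "(s\<^sup>2 + r\<^sup>2) powr (- (d / 2)) \<le> r powr (- d)"
proof -
  have "(s\<^sup>2 + r\<^sup>2) powr (- (d / 2)) \<le> (r\<^sup>2) powr (- (d / 2))"
    using r d by (intro powr_mono2') auto
  also have "\<dots> = (r powr 2) powr (- (d / 2))"
    using r by simp
  also have "\<dots> = r powr (- d)"
    by (simp only: powr_powr) simp
  finally show ?thesis .
qed

text \<open>The sign of the derivative in the increment is that of
  \<open>r^2 - (d - 1) z^2 + d z m\<close>. With \<open>z\<close> and \<open>m\<close> bounded by
  \<open>c r\<close> this is at least \<open>(1 - (2 d - 1) c^2) r^2\<close>, which is the source of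
  the constant \<open>2 d - 1\<close>.\<close>

lemma kern_mono:
  fixes d r c m s s' :: real
  assumes r: "r > 0" and d: "d \<ge> 1" and c: "c \<ge> 0" "(2 * d - 1) * c\<^sup>2 \<le> 1"
    and m: "\<bar>m\<bar> \<le> c * r" and s: "- (c * r) \<le> s" "s \<le> s'" "s' \<le> c * r"
  shows "kern d r s m \<le> kern d r s' m"
  unfolding kern_alt
proof (rule DERIV_nonneg_imp_nondecreasing[OF s(2)])
  fix z assume z: "s \<le> z" "z \<le> s'"
  let ?w = "(z\<^sup>2 + r\<^sup>2) powr (- (d / 2) - 1)"
  have pos: "z\<^sup>2 + r\<^sup>2 > 0"
    using r by (simp add: add_nonneg_pos)
  have zb: "\<bar>z\<bar> \<le> c * r"
    using z s by linarith
  have w: "(z\<^sup>2 + r\<^sup>2) powr (- (d / 2)) = (z\<^sup>2 + r\<^sup>2) * ?w"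
    using powr_add[of "z\<^sup>2 + r\<^sup>2" 1 "- (d / 2) - 1"] pos by simp
  have "z\<^sup>2 \<le> (c * r)\<^sup>2"
    using zb by (metis abs_ge_zero power2_abs power_mono)
  then have 1: "(d - 1) * z\<^sup>2 \<le> (d - 1) * (c * r)\<^sup>2"
    using d by (intro mult_left_mono) auto
  have "- (z * m) \<le> \<bar>z\<bar> * \<bar>m\<bar>"
    by (metis abs_ge_minus_self abs_mult)
  also have "\<dots> \<le> (c * r) * (c * r)"
    using zb m by (intro mult_mono) auto
  finally have "d * (- (z * m)) \<le> d * ((c * r) * (c * r))"
    using d by (intro mult_left_mono) auto
  moreover have "(2 * d - 1) * c\<^sup>2 * r\<^sup>2 \<le> 1 * r\<^sup>2"
    using c by (intro mult_right_mono) auto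
  ultimately have "z\<^sup>2 + r\<^sup>2 - d * z * (z - m) \<ge> 0"
    using 1 by (simp add: algebra_simps power2_eq_square)
  then have "(z\<^sup>2 + r\<^sup>2 - d * z * (z - m)) * ?w \<ge> 0"
    by simp
  moreover have "((\<lambda>s. (s - m) * (s\<^sup>2 + r\<^sup>2) powr (- (d / 2))) has_real_derivative
      (z\<^sup>2 + r\<^sup>2 - d * z * (z - m)) * ?w) (at z)"
    by (rule DERIV_cong[OF DERIV_mult[OF DERIV_diff[OF DERIV_ident DERIV_const] DERIV_weight[OF r]]])
      (simp add: w, simp add: algebra_simps)
  ultimately show "\<exists>y. ((\<lambda>s. (s - m) * (s\<^sup>2 + r\<^sup>2) powr (- (d / 2))) has_real_derivative y) (at z) \<and> y \<ge> 0"
    by blast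
qed

text \<open>The difference splits into a change of the weight, multiplied by \<open>s - m\<close>,
  and a change \<open>D - e\<close> of the numerator, multiplied by the new weight. The first uses
  the Lipschitz bound of the weight, the second its size.\<close>

lemma kern_shift_le:
  fixes d r s m D e b b' E :: real
  assumes r: "r > 0" and d: "d \<ge> 0"
    and D: "\<bar>D\<bar> \<le> E * r" and b: "\<bar>s - m\<bar> \<le> b"
    and e: "D - e \<le> b'" "b' \<ge> 0"
  shows "kern d r (s + D) (m + e) - kern d r s m \<le> b * d * E * r powr (- d) + b' * r powr (- d)"
proof -
  let ?w = "\<lambda>s. (s\<^sup>2 + r\<^sup>2) powr (- (d / 2))"
  have E: "E \<ge> 0"
    using order_trans[OF abs_ge_zero D] r by (simp add: zero_le_mult_iff)
  have "kern d r (s + D) (m + e) - kern d r s m = (s - m) * (?w (s + D) - ?w s) + (D - e) * ?w (s + D)"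
    by (simp add: kern_alt algebra_simps)
  also have "(s - m) * (?w (s + D) - ?w s) \<le> \<bar>s - m\<bar> * \<bar>?w (s + D) - ?w s\<bar>"
    by (metis abs_ge_self abs_mult)
  also have "\<dots> \<le> b * (d * r powr (- d - 1) * \<bar>D\<bar>)"
    using b weight_lipschitz[OF r d, of "s + D" s] by (intro mult_mono) auto
  also have "\<dots> \<le> b * (d * r powr (- d - 1) * (E * r))"
    using b d D by (intro mult_left_mono) auto
  also have "\<dots> = b * d * E * r powr (- d)"
    using r by (simp add: powr_diff)
  also have "(D - e) * ?w (s + D) \<le> b' * r powr (- d)"
    using e weight_le[OF r d, of "s + D"] by (intro mult_mono) auto
  finally show ?thesis by simp
qed

text \<open>The two kernels are compared through an intermediate increment \<open>s\<close> between
  \<open>A - D\<close> and \<open>B\<close>. Monotonicity replaces \<open>A\<close> by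
  \<open>s + D\<close> and \<open>B\<close> by \<open>s\<close>, which leaves a pure shift. The
  slope \<open>L + 2 * E\<close> leaves room for the shifted increments in the range of
  monotonicity.\<close>

lemma kern_diff_le:
  fixes d r A B D E L m e k :: real
  assumes r: "r > 0" and d: "d \<ge> 1" and L: "0 \<le> L" and E: "0 \<le> E" and k: "0 \<le> k"
    and c: "(2 * d - 1) * (L + 2 * E)\<^sup>2 \<le> 1"
    and m: "\<bar>m\<bar> \<le> L * r" "\<bar>m + e\<bar> \<le> L * r" "\<bar>e\<bar> \<le> E * r"
    and AB: "\<bar>A\<bar> \<le> L * r" "\<bar>B\<bar> \<le> L * r" and D: "\<bar>D\<bar> \<le> E * r" "D - e \<le> E * r\<^sup>2"
    and order: "A \<le> B + D" "A - D \<le> m + k * r\<^sup>2" "m - k * r\<^sup>2 \<le> B"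
  shows "kern d r A (m + e) - kern d r B m \<le> E * (2 + 2 * d + k * d) * r powr (2 - d)"
proof -
  \<comment> \<open>Near the origin the two-sided quadratic bounds give \<open>\<bar>s - m\<bar> \<le> k r\<^sup>2\<close>, which supplies the
    extra power of \<open>r\<close> that makes the bound integrable.\<close>
  define s where "s = (if r \<le> 1 then max (A - D) (m - k * r\<^sup>2) else B)"
  have c0: "L + 2 * E \<ge> 0"
    using L E by simp
  have cr: "(L + 2 * E) * r = L * r + 2 * (E * r)" "E * r \<ge> 0" "L * r \<ge> 0"
    using E L r by (auto simp: algebra_simps)
  have s: "A - D \<le> s" "s \<le> B"
    using order by (auto simp: s_def)
  have 1: "kern d r A (m + e) \<le> kern d r (s + D) (m + e)"
    by (rule kern_mono[OF r d c0 c]) (use m AB D s cr in linarith)+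
  have 2: "kern d r s m \<le> kern d r B m"
    by (rule kern_mono[OF r d c0 c]) (use m AB D s cr in linarith)+
  have "kern d r (s + D) (m + e) - kern d r s m \<le> E * (2 + 2 * d + k * d) * r powr (2 - d)"
  proof (cases "r \<le> 1")
    case True
    have "\<bar>s - m\<bar> \<le> k * r\<^sup>2"
      using order k r unfolding s_def if_P[OF True] by (simp add: abs_le_iff max_def)
    then have "kern d r (s + D) (m + e) - kern d r s m
        \<le> k * r\<^sup>2 * d * E * r powr (- d) + E * r\<^sup>2 * r powr (- d)"
      using E d D r by (intro kern_shift_le[OF r _ D(1)]) auto
    also have "\<dots> = E * (1 + k * d) * (r powr 2 * r powr (- d))"
      using r by (simp add: algebra_simps)
    also have "\<dots> = E * (1 + k * d) * r powr (2 - d)"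
      by (simp add: powr_add[symmetric])
    also have "\<dots> \<le> E * (2 + 2 * d + k * d) * r powr (2 - d)"
      using E d by (intro mult_right_mono mult_left_mono) auto
    finally show ?thesis .
  next
    case False
    have L1: "L \<le> 1"
    proof -
      have "1 * (L + 2 * E)\<^sup>2 \<le> (2 * d - 1) * (L + 2 * E)\<^sup>2"
        using d by (intro mult_right_mono) auto
      then have "(L + 2 * E)\<^sup>2 \<le> 1\<^sup>2"
        using c by simp
      then have "L + 2 * E \<le> 1"
        by (rule power2_le_imp_le) simp
      then show ?thesis using E by simp
    qed
    have "L * r \<le> r"
      using L1 r by simp
    then have "\<bar>s - m\<bar> \<le> 2 * r"
      using m(1) AB(2) unfolding s_def if_not_P[OF False] by linarith
    then have "kern d r (s + D) (m + e) - kern d r s m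
        \<le> 2 * r * d * E * r powr (- d) + 2 * (E * r) * r powr (- d)"
      using D m(3) d cr by (intro kern_shift_le[OF r _ D(1)]) linarith+
    also have "\<dots> = E * (2 + 2 * d) * (r powr 1 * r powr (- d))"
      using r by (simp add: algebra_simps)
    also have "\<dots> = E * (2 + 2 * d) * r powr (1 - d)"
      by (simp only: powr_add[symmetric]) simp
    \<comment> \<open>For \<open>r > 1\<close> the exponent may be raised by one, so that both cases
      end in the same power, integrable near the origin.\<close>
    also have "\<dots> \<le> E * (2 + 2 * d) * r powr (2 - d)"
      using E d False by (intro mult_left_mono powr_mono) auto
    also have "\<dots> \<le> E * (2 + 2 * d + k * d) * r powr (2 - d)"
      using E d k by (intro mult_right_mono mult_left_mono) auto
    finally show ?thesis .
  qed
  with 1 2 show ?thesis by linarith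
qed

text \<open>The subtracted term \<open>- m r powr (- d)\<close> is odd in \<open>h\<close> when \<open>m = v \<bullet> h\<close> and
  \<open>r = \<bar>h\<bar>\<close>, so it does not contribute to integrals over annuli.\<close>

lemma kern_far:
  fixes d r s m :: real
  assumes r: "r > 0" and d: "d \<ge> 0" and m: "\<bar>m\<bar> \<le> r"
  shows "\<bar>kern d r s m + m * r powr (- d)\<bar> \<le> (1 + d) * \<bar>s\<bar> * r powr (- d)"
proof -
  let ?w = "\<lambda>s. (s\<^sup>2 + r\<^sup>2) powr (- (d / 2))"
  have w0: "?w 0 = r powr (- d)"
  proof -
    have "?w 0 = (r powr 2) powr (- (d / 2))"
      using r by simp
    also have "\<dots> = r powr (- d)"
      by (simp only: powr_powr) simp
    finally show ?thesis .
  qed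
  have "kern d r s m + m * r powr (- d) = s * ?w s + m * (?w 0 - ?w s)"
    using w0 by (simp add: kern_alt algebra_simps)
  also have "\<bar>\<dots>\<bar> \<le> \<bar>s\<bar> * ?w s + \<bar>m\<bar> * \<bar>?w 0 - ?w s\<bar>"
    by (rule order_trans[OF abs_triangle_ineq]) (simp add: abs_mult)
  also have "\<dots> \<le> \<bar>s\<bar> * r powr (- d) + r * (d * r powr (- d - 1) * \<bar>s\<bar>)"
    using m r d weight_lipschitz[OF r d, of 0 s] weight_le[OF r d, of s]
    by (intro add_mono mult_mono) auto
  also have "\<dots> = (1 + d) * \<bar>s\<bar> * r powr (- d)"
    using r by (simp add: powr_diff algebra_simps)
  finally show ?thesis .
qed

subsection \<open>Integrals of radial functions\<close>

text \<open>Polar coordinates for radial functions: both measures give the half-line up to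
  \<open>a \<ge> 0\<close> the volume of a ball of radius \<open>a\<close>, and half-lines generate
  the Borel sets.\<close>

lemma distr_norm_lborel:
  "distr lborel borel (norm :: 'a::euclidean_space \<Rightarrow> real) =
     density lborel (\<lambda>r. ennreal (unit_ball_vol DIM('a) * DIM('a) * r ^ (DIM('a) - 1)) * indicator {0<..} r)"
  (is "?M = ?N")
proof (rule measure_eqI_generator_eq[where E = "range atMost" and \<Omega> = UNIV and A = "\<lambda>i. {..real i}"])
  let ?c = "unit_ball_vol DIM('a) * DIM('a)"
  show "Int_stable (range (atMost :: real \<Rightarrow> real set))"
    by (auto simp: Int_stable_def)
  show "sets ?M = sigma_sets UNIV (range atMost)" "sets ?N = sigma_sets UNIV (range atMost)"
    by (simp_all add: borel_eq_atMost[where 'a = real])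
  show "(\<Union>i. {..real i}) = UNIV"
    by (auto intro: real_arch_simple)
  have M: "emeasure ?M {..a} = emeasure lborel (cball (0::'a) a)" for a
    by (subst emeasure_distr) (auto intro!: arg_cong[where f = "emeasure lborel"])
  show "emeasure ?M {..real i} \<noteq> \<infinity>" for i
    unfolding M by (simp add: emeasure_cball)
  fix X :: "real set" assume "X \<in> range atMost"
  then obtain a where X: "X = {..a}" by auto
  have "emeasure ?N {..a} = (\<integral>\<^sup>+r. ennreal (?c * r ^ (DIM('a) - 1)) * indicator {0<..} r * indicator {..a} r \<partial>lborel)"
    by (rule emeasure_density) auto
  also have "\<dots> = emeasure lborel (cball (0::'a) a)"
  proof (cases "a \<ge> 0")
    case True
    have "(\<integral>\<^sup>+r. ennreal (?c * r ^ (DIM('a) - 1)) * indicator {0<..} r * indicator {..a} r \<partial>lborel)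
        = (\<integral>\<^sup>+r. ennreal (?c * r ^ (DIM('a) - 1)) * indicator {0..a} r \<partial>lborel)"
      using AE_lborel_singleton[of "0::real"]
      by (intro nn_integral_cong_AE, eventually_elim) (auto split: split_indicator)
    also have "\<dots> = ennreal (unit_ball_vol DIM('a) * a ^ DIM('a) - unit_ball_vol DIM('a) * 0 ^ DIM('a))"
      using True
      by (intro nn_integral_FTC_Icc) (auto intro!: derivative_eq_intros)
    finally show ?thesis
      using True by (simp add: emeasure_cball)
  next
    case False
    then have "(\<integral>\<^sup>+r. ennreal (?c * r ^ (DIM('a) - 1)) * indicator {0<..} r * indicator {..a} r \<partial>lborel)
        = (\<integral>\<^sup>+r. 0 \<partial>(lborel :: real measure))"
      by (intro nn_integral_cong) (auto split: split_indicator)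
    then show ?thesis
      using False by simp
  qed
  finally show "emeasure ?M X = emeasure ?N X"
    by (simp add: M X)
qed auto

lemma nn_integral_radial:
  fixes F :: "real \<Rightarrow> ennreal"
  assumes [measurable]: "F \<in> borel_measurable borel"
  shows "(\<integral>\<^sup>+h. F (norm (h::'a::euclidean_space)) \<partial>lborel) =
    (\<integral>\<^sup>+r. ennreal (unit_ball_vol DIM('a) * DIM('a) * r ^ (DIM('a) - 1)) * indicator {0<..} r * F r \<partial>lborel)"
proof -
  have "(\<integral>\<^sup>+h. F (norm (h::'a)) \<partial>lborel) = (\<integral>\<^sup>+r. F r \<partial>distr lborel borel (norm :: 'a \<Rightarrow> real))"
    by (simp add: nn_integral_distr)
  then show ?thesis
    by (simp add: distr_norm_lborel nn_integral_density)
qed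

text \<open>The power cancels the Jacobian, so the integral grows only linearly in \<open>R\<close>.
  Later \<open>R\<close> grows linearly with the position of the maximum, at the same rate as the
  weight at infinity.\<close>

lemma nn_integral_ball_radial:
  fixes R :: real
  assumes R: "R \<ge> 0"
  shows "(\<integral>\<^sup>+h. ennreal (norm h powr (1 - real DIM('a))) * indicator {..<R} (norm (h::'a::euclidean_space)) \<partial>lborel)
    = ennreal (unit_ball_vol DIM('a) * DIM('a) * R)"
proof -
  let ?c = "unit_ball_vol DIM('a) * DIM('a)"
  have "(\<integral>\<^sup>+h. ennreal (norm h powr (1 - real DIM('a))) * indicator {..<R} (norm (h::'a)) \<partial>lborel)
      = (\<integral>\<^sup>+r. ennreal (?c * r ^ (DIM('a) - 1)) * indicator {0<..} r
           * (ennreal (r powr (1 - real DIM('a))) * indicator {..<R} r) \<partial>lborel)"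
    by (rule nn_integral_radial) measurable
  also have "\<dots> = (\<integral>\<^sup>+r. ennreal ?c * indicator {0<..<R} r \<partial>lborel)"
  proof (intro nn_integral_cong)
    fix r :: real
    have "r ^ (DIM('a) - 1) * r powr (1 - real DIM('a)) = 1" if "r > 0"
    proof -
      have "r ^ (DIM('a) - 1) = r powr (real DIM('a) - 1)"
        using that by (simp add: powr_realpow[symmetric] of_nat_diff)
      then show ?thesis
        using that by (simp add: powr_add[symmetric])
    qed
    then show "ennreal (?c * r ^ (DIM('a) - 1)) * indicator {0<..} r
           * (ennreal (r powr (1 - real DIM('a))) * indicator {..<R} r) = ennreal ?c * indicator {0<..<R} r"
      by (auto split: split_indicator simp: ennreal_mult[symmetric] mult.assoc)
  qed
  also have "\<dots> = ennreal ?c * ennreal R"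
    using R by (simp add: nn_integral_cmult_indicator)
  finally show ?thesis
    using R by (simp add: ennreal_mult)
qed

text \<open>The Jacobian reduces the power to \<open>r^-2\<close>, the weight in the integrability
  condition on \<open>\<Omega>\<close>.\<close>

lemma nn_integral_tail_radial:
  fixes R :: real and G :: "real \<Rightarrow> real"
  assumes R: "R > 0" and G: "\<And>r. G r \<ge> 0" and [measurable]: "G \<in> borel_measurable borel"
  shows "(\<integral>\<^sup>+h. ennreal (G (norm h) * norm h powr (- real (DIM('a) + 1))) * indicator {R..} (norm (h::'a::euclidean_space)) \<partial>lborel)
    = ennreal (unit_ball_vol DIM('a) * DIM('a)) * (\<integral>\<^sup>+r. ennreal (G r / r\<^sup>2) * indicator {R..} r \<partial>lborel)"
proof -
  let ?c = "unit_ball_vol DIM('a) * DIM('a)"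
  have "(\<integral>\<^sup>+h. ennreal (G (norm h) * norm h powr (- real (DIM('a) + 1))) * indicator {R..} (norm (h::'a)) \<partial>lborel)
      = (\<integral>\<^sup>+r. ennreal (?c * r ^ (DIM('a) - 1)) * indicator {0<..} r
           * (ennreal (G r * r powr (- real (DIM('a) + 1))) * indicator {R..} r) \<partial>lborel)"
    by (rule nn_integral_radial) measurable
  also have "\<dots> = (\<integral>\<^sup>+r. ennreal ?c * (ennreal (G r / r\<^sup>2) * indicator {R..} r) \<partial>lborel)"
  proof (intro nn_integral_cong)
    fix r :: real
    have eq: "r ^ (DIM('a) - 1) * (G r * r powr (- real (DIM('a) + 1))) = G r / r\<^sup>2" if "r > 0"
    proof -
      have "r ^ (DIM('a) - 1) = r powr (real DIM('a) - 1)"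
        using that by (simp add: powr_realpow[symmetric] of_nat_diff)
      then have "r ^ (DIM('a) - 1) * r powr (- real (DIM('a) + 1)) = r powr - 2"
        using that by (simp add: powr_add[symmetric])
      also have "\<dots> = 1 / r\<^sup>2"
        using that by (simp add: powr_minus_divide)
      finally show ?thesis
        by (simp add: mult.left_commute)
    qed
    show "ennreal (?c * r ^ (DIM('a) - 1)) * indicator {0<..} r
           * (ennreal (G r * r powr (- real (DIM('a) + 1))) * indicator {R..} r)
         = ennreal ?c * (ennreal (G r / r\<^sup>2) * indicator {R..} r)"
    proof (cases "R \<le> r")
      case True
      then have r: "r > 0" using R by simp
      have "ennreal (?c * r ^ (DIM('a) - 1)) * ennreal (G r * r powr (- real (DIM('a) + 1)))
          = ennreal (?c * (r ^ (DIM('a) - 1) * (G r * r powr (- real (DIM('a) + 1)))))"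
        using r G[of r] by (subst ennreal_mult[symmetric]) (auto simp: mult.assoc)
      also have "\<dots> = ennreal ?c * ennreal (G r / r\<^sup>2)"
        unfolding eq[OF r] using G[of r] by (subst ennreal_mult) auto
      finally show ?thesis
        using True r by simp
    qed simp
  qed
  also have "\<dots> = ennreal ?c * (\<integral>\<^sup>+r. ennreal (G r / r\<^sup>2) * indicator {R..} r \<partial>lborel)"
    by (rule nn_integral_cmult) measurable
  finally show ?thesis .
qed

subsection \<open>Differences of principal values\<close>

text \<open>Moves the singularity to the origin, so that principal values at two different points
  become limits over the same annuli and can be subtracted.\<close>

lemma has_pv_integral_translate:
  assumes "has_pv_integral u x I"
  shows "has_pv_integral (\<lambda>h. u (x + h)) 0 I"
proof -
  let ?A = "\<lambda>x a b. {y. a \<le> dist x y \<and> dist x y \<le> b}"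
  have int: "set_integrable lborel (?A 0 a b) (\<lambda>h. u (x + h)) \<and>
      set_lebesgue_integral lborel (?A 0 a b) (\<lambda>h. u (x + h)) = set_lebesgue_integral lborel (?A x a b) u"
    if "0 < a" "a < b" for a b
  proof -
    let ?f = "\<lambda>y. indicator (?A x a b) y *\<^sub>R u y"
    have f: "integrable lborel ?f"
      using assms that by (simp add: has_pv_integral_def set_integrable_def)
    then have meas: "?f \<in> borel_measurable borel"
      by (auto dest: borel_measurable_integrable)
    have eq: "indicator (?A 0 a b) h *\<^sub>R u (x + h) = ?f (x + h)" for h
      by (auto simp: dist_norm split: split_indicator)
    have "integrable (distr lborel borel ((+) x)) ?f"
      using f by (simp add: lborel_distr_plus)
    then have "integrable lborel (\<lambda>h. ?f (x + h))"
      by (subst (asm) integrable_distr_eq) (use meas in auto)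
    moreover have "integral\<^sup>L lborel ?f = integral\<^sup>L (distr lborel borel ((+) x)) ?f"
      by (simp add: lborel_distr_plus)
    then have "integral\<^sup>L lborel ?f = integral\<^sup>L lborel (\<lambda>h. ?f (x + h))"
      by (subst (asm) integral_distr) (use meas in auto)
    ultimately show ?thesis
      by (simp only: set_integrable_def set_lebesgue_integral_def eq)
  qed
  \<comment> \<open>The truncated integrals are matched only for \<open>0 < a < b\<close>, which
    holds eventually along the product filter.\<close>
  have "\<forall>\<^sub>F p in at_right 0 \<times>\<^sub>F at_top. 0 < fst p \<and> fst p < (snd p :: real)"
  proof -
    have "\<forall>\<^sub>F a in at_right 0. a \<in> {0<..<1::real}"
      by (rule eventually_at_right_real) simp
    from eventually_prodI[OF this eventually_gt_at_top[of "1::real"]] show ?thesis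
      by (rule eventually_mono) auto
  qed
  then have ev: "\<forall>\<^sub>F p in at_right 0 \<times>\<^sub>F at_top.
      (\<lambda>(a, b). set_lebesgue_integral lborel (?A x a b) u) p =
      (\<lambda>(a, b). set_lebesgue_integral lborel (?A 0 a b) (\<lambda>h. u (x + h))) p"
    by (rule eventually_mono) (use int in auto)
  have "((\<lambda>(a, b). set_lebesgue_integral lborel (?A 0 a b) (\<lambda>h. u (x + h))) \<longlongrightarrow> I) (at_right 0 \<times>\<^sub>F at_top)"
    by (rule Lim_transform_eventually[OF _ ev]) (use assms in \<open>simp add: has_pv_integral_def\<close>)
  then show ?thesis
    using int by (simp add: has_pv_integral_def)
qed

lemma lborel_distr_uminus_euclidean: "distr lborel borel uminus = (lborel :: 'a::euclidean_space measure)"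
  by (subst lborel_affine[of "-1" 0]) (auto simp: density_1)

text \<open>Reflection preserves Lebesgue measure, so the integral equals its own negative. A
  non-integrable \<open>q\<close> is covered as well, its Bochner integral being 0.\<close>

lemma integral_odd_eq_0:
  fixes q :: "'a::euclidean_space \<Rightarrow> real"
  assumes "q \<in> borel_measurable borel" and odd: "\<And>h. q (- h) = - q h"
  shows "integral\<^sup>L lborel q = 0"
proof -
  have "integral\<^sup>L lborel q = integral\<^sup>L (distr lborel borel uminus) q"
    by (simp add: lborel_distr_uminus_euclidean)
  also have "\<dots> = integral\<^sup>L lborel (\<lambda>h. q (- h))"
    by (rule integral_distr) (use assms in auto)
  also have "\<dots> = - integral\<^sup>L lborel q"
    by (simp add: odd)
  finally show ?thesis by simp
qed

text \<open>On each annulus the odd function \<open>q\<close> integrates to 0 and can be added for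
  free; the bound is then uniform in the annulus and passes to the limit. Since
  \<open>ennreal\<close> sends negative numbers to 0, \<open>G\<close> is asked to dominate only the
  positive part.\<close>

lemma has_pv_integral_diff_le:
  fixes k l q :: "'a::euclidean_space \<Rightarrow> real"
  assumes k: "has_pv_integral k 0 I" and l: "has_pv_integral l 0 J"
    and q: "q \<in> borel_measurable borel" "\<And>h. q (- h) = - q h"
      "\<And>a b. 0 < a \<Longrightarrow> a < b \<Longrightarrow> set_integrable lborel {h. a \<le> norm h \<and> norm h \<le> b} q"
    and le: "\<And>h. h \<noteq> 0 \<Longrightarrow> ennreal (k h - l h + q h) \<le> G h"
    and G: "(\<integral>\<^sup>+h. G h \<partial>lborel) \<le> ennreal C" and C: "C \<ge> 0"
  shows "I - J \<le> C"
proof -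
  let ?A = "\<lambda>a b. {h::'a. a \<le> norm h \<and> norm h \<le> b}"
  let ?I = "\<lambda>k (a, b). set_lebesgue_integral lborel (?A a b) k"
  let ?F = "at_right (0::real) \<times>\<^sub>F (at_top :: real filter)"
  have F: "?F \<noteq> bot"
    by (simp add: prod_filter_eq_bot)
  have "((\<lambda>p. ?I k p - ?I l p) \<longlongrightarrow> I - J) ?F"
    using k l unfolding has_pv_integral_def by (intro tendsto_diff) auto
  moreover have "\<forall>\<^sub>F p in ?F. ?I k p - ?I l p \<le> C"
  proof -
    have bound: "?I k (a, b) - ?I l (a, b) \<le> C" if ab: "0 < a" "a < b" for a b
    proof -
      have ki: "integrable lborel (\<lambda>h. indicator (?A a b) h *\<^sub>R k h)"
        and li: "integrable lborel (\<lambda>h. indicator (?A a b) h *\<^sub>R l h)"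
        using k l ab unfolding has_pv_integral_def set_integrable_def by auto
      have qi: "integrable lborel (\<lambda>h. indicator (?A a b) h *\<^sub>R q h)"
        using q(3)[OF ab] by (simp add: set_integrable_def)
      have "?I q (a, b) = 0"
        unfolding set_lebesgue_integral_def prod.case
        using q(1,2) by (intro integral_odd_eq_0) (auto simp: split: split_indicator)
      then have "?I k (a, b) - ?I l (a, b) = ?I k (a, b) - ?I l (a, b) + ?I q (a, b)"
        by simp
      also have "\<dots> = (LINT h|lborel. indicator (?A a b) h *\<^sub>R k h - indicator (?A a b) h *\<^sub>R l h
          + indicator (?A a b) h *\<^sub>R q h)"
        using ki li qi by (simp add: set_lebesgue_integral_def)
      also have "\<dots> \<le> C"
      proof (rule integral_real_bounded[OF C])
        have "ennreal (indicator (?A a b) h *\<^sub>R k h - indicator (?A a b) h *\<^sub>R l h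
            + indicator (?A a b) h *\<^sub>R q h) \<le> G h" for h
        proof (cases "h \<in> ?A a b")
          case True
          then have "h \<noteq> 0" using ab by auto
          from le[OF this] True show ?thesis by simp
        qed simp
        then show "(\<integral>\<^sup>+h. ennreal (indicator (?A a b) h *\<^sub>R k h - indicator (?A a b) h *\<^sub>R l h
            + indicator (?A a b) h *\<^sub>R q h) \<partial>lborel) \<le> ennreal C"
          using G by (meson nn_integral_mono order_trans)
      qed
      finally show ?thesis .
    qed
    have "\<forall>\<^sub>F a in at_right 0. a \<in> {0<..<1::real}"
      by (rule eventually_at_right_real) simp
    from eventually_prodI[OF this eventually_gt_at_top[of "1::real"]] show ?thesis
      by (rule eventually_mono) (use bound in \<open>auto split: prod.splits\<close>)
  qed
  ultimately show ?thesis
    using F by (rule tendsto_upperbound)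
qed

lemma set_integrable_annulus_odd_kernel:
  fixes w :: "'a::euclidean_space"
  assumes "0 < a"
  shows "set_integrable lborel {h. a \<le> norm h \<and> norm h \<le> b}
           (\<lambda>h. indicator {R..} (norm h) * (w \<bullet> h * norm h powr p))"
proof -
  let ?A = "{h::'a. a \<le> norm h \<and> norm h \<le> b}"
  have "closed ?A"
    by (intro closed_Collect_conj closed_Collect_le continuous_intros)
  moreover have "bounded ?A"
    by (auto simp: bounded_iff)
  ultimately have "compact ?A"
    by (simp add: compact_eq_bounded_closed)
  moreover have "continuous_on ?A (\<lambda>h. w \<bullet> h * norm h powr p)"
    using assms by (intro continuous_intros) auto
  ultimately have "integrable lborel (\<lambda>h. indicator ?A h *\<^sub>R (w \<bullet> h * norm h powr p))"
    by (rule borel_integrable_compact)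
  then have "integrable lborel (\<lambda>h. indicator {h. R \<le> norm h} h *\<^sub>R (indicator ?A h *\<^sub>R (w \<bullet> h * norm h powr p)))"
    by (rule integrable_mult_indicator[rotated]) simp
  then show ?thesis
    unfolding set_integrable_def
    by (rule Bochner_Integration.integrable_cong[THEN iffD1, rotated -1]) (auto split: split_indicator)
qed

lemma muskat_integrand_shift:
  fixes u :: "real^'n \<Rightarrow> real"
  shows "muskat_integrand u x (x + h) =
    kern (real (CARD('n) + 1)) (norm h) (u (x + h) - u x) (grad u x \<bullet> h)"
  by (simp add: muskat_integrand_def kern_def)

text \<open>Inside radius \<open>R\<close> the assumed power integrates to a multiple of
  \<open>P * R\<close>. Outside, the linear parts decay only like the power \<open>1 - d\<close> of
  the length of \<open>h\<close>, which just fails to be integrable at infinity. They are odd, so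
  they are removed first, and the rest of each kernel costs a multiple of
  \<open>(1 + d) * \<tau>\<close>.\<close>

lemma muskat_pv_diff_le:
  fixes u w :: "real^'n \<Rightarrow> real" and N :: "real \<Rightarrow> real"
  defines "d \<equiv> real (CARD('n) + 1)"
  assumes u: "has_pv_integral (muskat_integrand u x) x I"
    and w: "has_pv_integral (muskat_integrand w y) y J"
    and grads: "norm (grad u x) \<le> 1" "norm (grad w y) \<le> 1"
    and near: "\<And>h. h \<noteq> 0 \<Longrightarrow> norm h < R \<Longrightarrow>
        kern d (norm h) (u (x + h) - u x) (grad u x \<bullet> h)
          - kern d (norm h) (w (y + h) - w y) (grad w y \<bullet> h) \<le> P * norm h powr (2 - d)"
    and far: "\<And>h. R \<le> norm h \<Longrightarrow> \<bar>u (x + h) - u x\<bar> \<le> N (norm h)"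
      "\<And>h. R \<le> norm h \<Longrightarrow> \<bar>w (y + h) - w y\<bar> \<le> N (norm h)"
    and N: "\<And>r. N r \<ge> 0" "N \<in> borel_measurable borel"
      "(\<integral>\<^sup>+r. ennreal (N r / r\<^sup>2) * indicator {R..} r \<partial>lborel) \<le> ennreal \<tau>"
    and R: "R > 0" and P: "P \<ge> 0" and \<tau>: "\<tau> \<ge> 0"
  shows "I - J \<le> unit_ball_vol CARD('n) * CARD('n) * (P * R + 2 * (1 + d) * \<tau>)"
proof -
  let ?c = "unit_ball_vol CARD('n) * CARD('n)"
  let ?k = "\<lambda>h. kern d (norm h) (u (x + h) - u x) (grad u x \<bullet> h)"
  let ?l = "\<lambda>h. kern d (norm h) (w (y + h) - w y) (grad w y \<bullet> h)"
  \<comment> \<open>The radial cut-off preserves oddness and leaves the near region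
    untouched.\<close>
  let ?q = "\<lambda>h::real^'n. indicator {R..} (norm h) * ((grad u x - grad w y) \<bullet> h * norm h powr (- d))"
  let ?G1 = "\<lambda>h::real^'n. ennreal P * (ennreal (norm h powr (1 - real DIM(real^'n))) * indicator {..<R} (norm h))"
  let ?G2 = "\<lambda>h::real^'n. ennreal (2 * (1 + d)) * (ennreal (N (norm h) * norm h powr (- real (DIM(real^'n) + 1))) * indicator {R..} (norm h))"
  note [measurable] = N(2)
  have d: "d \<ge> 0"
    by (simp add: d_def)
  have DIM: "DIM(real^'n) = CARD('n)"
    by simp
  have le: "ennreal (?k h - ?l h + ?q h) \<le> ?G1 h + ?G2 h" if "h \<noteq> 0" for h
  proof (cases "norm h < R")
    case True
    have "?k h - ?l h + ?q h \<le> P * norm h powr (1 - real CARD('n))"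
      using near[OF that True] True by (simp add: d_def)
    then have "ennreal (?k h - ?l h + ?q h) \<le> ennreal (P * norm h powr (1 - real CARD('n)))"
      by (rule ennreal_leI)
    then show ?thesis
      using True P by (simp add: ennreal_mult)
  next
    case False
    then have hR: "R \<le> norm h" and h: "norm h > 0"
      using R by auto
    have m: "\<bar>v \<bullet> h\<bar> \<le> norm h" if "norm v \<le> 1" for v :: "real^'n"
      using Cauchy_Schwarz_ineq2[of v h] mult_right_mono[OF that norm_ge_zero[of h]] by simp
    have pw: "norm h powr - d \<ge> 0"
      by simp
    have "\<bar>?k h + grad u x \<bullet> h * norm h powr - d\<bar> \<le> (1 + d) * N (norm h) * norm h powr - d"
      using kern_far[OF h d m[OF grads(1)], of "u (x + h) - u x"]
        mult_right_mono[OF mult_left_mono[OF far(1)[OF hR], of "1 + d"] pw] d by linarith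
    moreover have "\<bar>?l h + grad w y \<bullet> h * norm h powr - d\<bar> \<le> (1 + d) * N (norm h) * norm h powr - d"
      using kern_far[OF h d m[OF grads(2)], of "w (y + h) - w y"]
        mult_right_mono[OF mult_left_mono[OF far(2)[OF hR], of "1 + d"] pw] d by linarith
    moreover have "?k h - ?l h + ?q h = (?k h + grad u x \<bullet> h * norm h powr - d)
        - (?l h + grad w y \<bullet> h * norm h powr - d)"
      using hR by (simp add: inner_diff_left algebra_simps)
    ultimately have "?k h - ?l h + ?q h \<le> 2 * (1 + d) * (N (norm h) * norm h powr - d)"
      by (simp add: algebra_simps abs_le_iff)
    then have "ennreal (?k h - ?l h + ?q h) \<le> ennreal (2 * (1 + d) * (N (norm h) * norm h powr - d))"
      by (rule ennreal_leI)
    also have "\<dots> = ennreal (2 * (1 + d)) * ennreal (N (norm h) * norm h powr - d)"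
      using d N(1) by (intro ennreal_mult) auto
    also have "\<dots> = ?G2 h"
      using hR by (simp add: d_def)
    finally show ?thesis
      by (simp add: add_increasing)
  qed
  have "(\<integral>\<^sup>+h. ?G1 h + ?G2 h \<partial>lborel) = (\<integral>\<^sup>+h. ?G1 h \<partial>lborel) + (\<integral>\<^sup>+h. ?G2 h \<partial>lborel)"
    by (intro nn_integral_add) measurable
  also have "(\<integral>\<^sup>+h. ?G1 h \<partial>lborel) = ennreal P * ennreal (?c * R)"
    using nn_integral_ball_radial[where 'a = "real^'n", of R] R
    by (subst nn_integral_cmult) (simp_all add: DIM)
  also have "(\<integral>\<^sup>+h. ?G2 h \<partial>lborel) = ennreal (2 * (1 + d)) * (ennreal ?c * (\<integral>\<^sup>+r. ennreal (N r / r\<^sup>2) * indicator {R..} r \<partial>lborel))"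
    using nn_integral_tail_radial[where 'a = "real^'n", OF R N(1,2)]
    by (subst nn_integral_cmult) (simp_all add: DIM)
  also have "ennreal P * ennreal (?c * R) + \<dots> \<le> ennreal P * ennreal (?c * R) + ennreal (2 * (1 + d)) * (ennreal ?c * ennreal \<tau>)"
    using N(3) by (intro add_left_mono mult_left_mono) auto
  also have "\<dots> = ennreal (?c * (P * R + 2 * (1 + d) * \<tau>))"
    using d P R \<tau> by (simp add: ennreal_mult[symmetric] ennreal_plus[symmetric] algebra_simps del: ennreal_plus)
  finally have G: "(\<integral>\<^sup>+h. ?G1 h + ?G2 h \<partial>lborel) \<le> ennreal (?c * (P * R + 2 * (1 + d) * \<tau>))" .
  show ?thesis
  proof (rule has_pv_integral_diff_le[OF _ _ _ _ _ le G])
    show "has_pv_integral ?k 0 I" "has_pv_integral ?l 0 J"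
      using has_pv_integral_translate[OF u] has_pv_integral_translate[OF w]
      by (simp_all add: muskat_integrand_shift d_def)
    show "set_integrable lborel {h. a \<le> norm h \<and> norm h \<le> b} ?q" if "0 < a" for a b
      by (rule set_integrable_annulus_odd_kernel[OF that])
    show "?c * (P * R + 2 * (1 + d) * \<tau>) \<ge> 0"
      using d P R \<tau> by simp
  qed (auto simp: algebra_simps)
qed

subsection \<open>Growth at infinity\<close>

lemma nn_integral_tail_le:
  fixes F :: "real \<Rightarrow> ennreal"
  assumes [measurable]: "F \<in> borel_measurable borel"
    and fin: "(\<integral>\<^sup>+r. F r * indicator {c..} r \<partial>lborel) < \<infinity>" and \<tau>: "\<tau> > 0"
  obtains R0 where "R0 \<ge> c" "\<And>R. R \<ge> R0 \<Longrightarrow> (\<integral>\<^sup>+r. F r * indicator {R..} r \<partial>lborel) \<le> \<tau>"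
proof -
  have "(\<lambda>i. \<integral>\<^sup>+r. F r * indicator {max c (real i)..} r \<partial>lborel) \<longlonglongrightarrow> (\<integral>\<^sup>+r. 0 \<partial>(lborel::real measure))"
  proof (rule nn_integral_dominated_convergence[where w = "\<lambda>r. F r * indicator {c..} r"])
    show "AE r in lborel. (\<lambda>i. F r * indicator {max c (real i)..} r) \<longlonglongrightarrow> 0"
    proof (rule AE_I2)
      fix r :: real
      obtain n :: nat where "r < n"
        using reals_Archimedean2 by blast
      then have "\<forall>\<^sub>F i in sequentially. F r * indicator {max c (real i)..} r = 0"
        by (intro eventually_sequentiallyI[of n]) (auto split: split_indicator)
      then show "(\<lambda>i. F r * indicator {max c (real i)..} r) \<longlonglongrightarrow> 0"
        by (rule tendsto_eventually)
    qed
  qed (use fin in \<open>auto split: split_indicator\<close>)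
  then have "\<forall>\<^sub>F i in sequentially. (\<integral>\<^sup>+r. F r * indicator {max c (real i)..} r \<partial>lborel) < \<tau>"
    using \<tau> by (intro order_tendstoD) auto
  then obtain i where i: "(\<integral>\<^sup>+r. F r * indicator {max c (real i)..} r \<partial>lborel) < \<tau>"
    by (auto simp: eventually_sequentially)
  show thesis
  proof
    fix R assume "R \<ge> max c (real i)"
    then have "(\<integral>\<^sup>+r. F r * indicator {R..} r \<partial>lborel) \<le> (\<integral>\<^sup>+r. F r * indicator {max c (real i)..} r \<partial>lborel)"
      by (intro nn_integral_mono) (auto split: split_indicator)
    with i show "(\<integral>\<^sup>+r. F r * indicator {R..} r \<partial>lborel) \<le> \<tau>"
      by simp
  qed simp
qed

text \<open>Since \<open>1 / r\<close> is the integral of \<open>1 / s^2\<close> over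
  \<open>s \<ge> r\<close>, monotonicity bounds \<open>N r / r\<close> by the tail of a convergent
  integral.\<close>

lemma sublinear_growth:
  fixes N :: "real \<Rightarrow> real"
  assumes mono: "mono N" and nonneg: "\<And>r. N r \<ge> 0"
    and fin: "(\<integral>\<^sup>+r. ennreal (N r / r\<^sup>2) * indicator {1..} r \<partial>lborel) < \<infinity>" and \<kappa>: "\<kappa> > 0"
  obtains C where "C \<ge> 0" "\<And>r. r \<ge> 0 \<Longrightarrow> N r \<le> \<kappa> * r + C"
proof -
  have [measurable]: "N \<in> borel_measurable borel"
    by (rule borel_measurable_mono[OF mono])
  obtain R where R: "R \<ge> 1" "\<And>r. r \<ge> R \<Longrightarrow> (\<integral>\<^sup>+s. ennreal (N s / s\<^sup>2) * indicator {r..} s \<partial>lborel) \<le> ennreal \<kappa>"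
    by (rule nn_integral_tail_le[OF _ fin, of "ennreal \<kappa>"]) (use \<kappa> in auto)
  have large: "N r \<le> \<kappa> * r" if "r \<ge> R" for r
  proof -
    have r: "r > 0" using R(1) that by simp
    have "(\<integral>\<^sup>+s. ennreal (1 / s\<^sup>2) * indicator {r..} s \<partial>lborel) = ennreal (0 - (- (1 / r)))"
    proof (rule nn_integral_FTC_atLeast)
      show "((\<lambda>s::real. - (1 / s)) \<longlongrightarrow> 0) at_top"
        using tendsto_minus[OF tendsto_inverse_0_at_top[OF filterlim_ident]]
        by (simp add: inverse_eq_divide)
      show "((\<lambda>s::real. - (1 / s)) has_real_derivative 1 / s\<^sup>2) (at s)" if "r \<le> s" for s
        using that r by (auto intro!: derivative_eq_intros simp: power2_eq_square)
    qed auto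
    then have "ennreal (N r * (1 / r)) = ennreal (N r) * (\<integral>\<^sup>+s. ennreal (1 / s\<^sup>2) * indicator {r..} s \<partial>lborel)"
      using nonneg[of r] r by (simp add: ennreal_mult[symmetric])
    also have "\<dots> = (\<integral>\<^sup>+s. ennreal (N r) * (ennreal (1 / s\<^sup>2) * indicator {r..} s) \<partial>lborel)"
      by (rule nn_integral_cmult[symmetric]) measurable
    also have "\<dots> \<le> (\<integral>\<^sup>+s. ennreal (N s / s\<^sup>2) * indicator {r..} s \<partial>lborel)"
    proof (rule nn_integral_mono)
      fix s :: real
      have "ennreal (N r) * ennreal (1 / s\<^sup>2) \<le> ennreal (N s / s\<^sup>2)" if "r \<le> s"
        using monoD[OF mono that] nonneg[of r]
        by (subst ennreal_mult[symmetric]) (auto intro!: ennreal_leI divide_right_mono)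
      then show "ennreal (N r) * (ennreal (1 / s\<^sup>2) * indicator {r..} s) \<le> ennreal (N s / s\<^sup>2) * indicator {r..} s"
        by (auto split: split_indicator)
    qed
    also have "\<dots> \<le> ennreal \<kappa>"
      by (rule R(2)[OF that])
    finally have "N r * (1 / r) \<le> \<kappa>"
      using \<kappa> by simp
    then show ?thesis
      using r by (simp add: field_simps)
  qed
  show thesis
  proof
    show "N R \<ge> 0" by (rule nonneg)
    fix r :: real assume r: "r \<ge> 0"
    show "N r \<le> \<kappa> * r + N R"
    proof (cases "r \<ge> R")
      case True
      then show ?thesis
        using large[OF True] nonneg[of R] by linarith
    next
      case False
      then show ?thesis
        using monoD[OF mono, of r R] r \<kappa> by (simp add: add_increasing)
    qed
  qed
qed

text \<open>The moduli are applied only at the spatial origin, so one compact set, a time interval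
  times a point, controls the growth for the whole slab. The factor 2 in
  \<open>norm h < 2 * r\<close> later accommodates points \<open>x + h\<close> with \<open>x\<close>
  shorter than \<open>h\<close>.\<close>

lemma muskat_growth:
  fixes f :: "real \<Rightarrow> real^'n \<Rightarrow> real"
  assumes f: "muskat_classical rel T f" and ab: "0 < a" "b < T"
  obtains N where "mono N" "\<And>r. N r \<ge> 0"
    "\<And>t h r. t \<in> {a..b} \<Longrightarrow> norm h < 2 * r \<Longrightarrow> \<bar>f t h - f t 0\<bar> \<le> N r"
    "(\<integral>\<^sup>+r. ennreal (N r / r\<^sup>2) * indicator {1..} r \<partial>lborel) < \<infinity>"
proof -
  let ?K = "{a..b} \<times> {0::real^'n}"
  have "compact ?K \<and> ?K \<subseteq> {0<..<T} \<times> UNIV"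
    using ab by (auto intro!: compact_Times)
  from f[unfolded muskat_classical_def, THEN conjunct2, THEN conjunct2, THEN conjunct2, THEN conjunct1,
      THEN spec[of _ ?K], THEN mp, OF this]
  obtain \<omega> \<Omega> :: "real \<Rightarrow> real" where \<Omega>: "\<forall>r\<ge>0. 0 \<le> \<Omega> r"
      "\<forall>R\<ge>0. \<forall>(t, x)\<in>?K. \<forall>h\<in>ball 0 R. \<bar>f t (x + h) - f t x\<bar> \<le> \<Omega> R"
      "(\<integral>\<^sup>+r\<in>{0<..1}. ennreal (\<omega> r / r) \<partial>lborel) + (\<integral>\<^sup>+R\<in>{1..}. ennreal (\<Omega> R / R\<^sup>2) \<partial>lborel) < \<infinity>"
    by (elim exE conjE) (rule that, assumption+)
  \<comment> \<open>The largest monotone minorant of \<open>\<Omega>\<close> bounds the same increments.\<close>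
  define M where "M r = Inf (\<Omega> ` {max 0 r..})" for r
  have bdd: "bdd_below (\<Omega> ` {max 0 r..})" for r
    using \<Omega>(1) by (intro bdd_belowI2[of _ 0]) auto
  have mono_M: "mono M"
    unfolding M_def by (intro monoI cInf_superset_mono bdd image_mono) auto
  have M0: "M r \<ge> 0" for r
    unfolding M_def
  proof (rule cInf_greatest)
    fix y assume "y \<in> \<Omega> ` {max 0 r..}"
    then obtain s where "y = \<Omega> s" "0 \<le> s"
      by (meson atLeast_iff image_iff max.bounded_iff)
    then show "y \<ge> 0" using \<Omega>(1) by blast
  qed simp
  have M\<Omega>: "M r \<le> \<Omega> r" if "r \<ge> 0" for r
    unfolding M_def using that by (intro cInf_lower bdd) auto
  have M_bound: "\<bar>f t h - f t 0\<bar> \<le> M r" if t: "t \<in> {a..b}" and h: "norm h < r" for t h r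
    unfolding M_def
  proof (rule cInf_greatest)
    fix y assume "y \<in> \<Omega> ` {max 0 r..}"
    then obtain s where s: "y = \<Omega> s" "s \<ge> 0" "s \<ge> r"
      by (meson atLeast_iff image_iff max.bounded_iff)
    have "h \<in> ball 0 s" using h s by simp
    with \<Omega>(2) s(2) t have "\<bar>f t (0 + h) - f t 0\<bar> \<le> \<Omega> s" by blast
    then show "\<bar>f t h - f t 0\<bar> \<le> y" by (simp add: s)
  qed auto
  have [measurable]: "M \<in> borel_measurable borel"
    by (rule borel_measurable_mono[OF mono_M])
  let ?F = "\<lambda>s. ennreal (M s / s\<^sup>2) * indicator {1..} s"
  have "(\<integral>\<^sup>+s. ?F s \<partial>lborel) \<le> (\<integral>\<^sup>+R\<in>{1..}. ennreal (\<Omega> R / R\<^sup>2) \<partial>lborel)"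
    using M\<Omega> by (intro nn_integral_mono) (auto split: split_indicator intro!: ennreal_leI divide_right_mono)
  also have "\<dots> < \<infinity>"
    using \<Omega>(3) by (simp add: ennreal_add_eq_top less_top)
  finally have finM: "(\<integral>\<^sup>+s. ?F s \<partial>lborel) < \<infinity>" .
  show thesis
  proof
    show "mono (\<lambda>r. M (2 * r))"
      using monoD[OF mono_M] by (intro monoI) simp
    show "M (2 * r) \<ge> 0" for r by (rule M0)
    show "\<bar>f t h - f t 0\<bar> \<le> M (2 * r)" if "t \<in> {a..b}" "norm h < 2 * r" for t h r
      by (rule M_bound[OF that])
    \<comment> \<open>Rescaling the variable by 2 changes the integral by constant factors and moves
      the lower limit from 1 to 2, inside the range of integrability.\<close>
    have "(\<integral>\<^sup>+r. ennreal (M (2 * r) / r\<^sup>2) * indicator {1..} r \<partial>lborel) \<le> (\<integral>\<^sup>+r. 4 * ?F (0 + 2 * r) \<partial>lborel)"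
    proof (rule nn_integral_mono)
      fix r :: real
      have "ennreal (M (2 * r) / r\<^sup>2) = 4 * ennreal (M (2 * r) / (2 * r)\<^sup>2)"
        using M0[of "2 * r"] by (simp add: ennreal_mult[symmetric] ennreal_numeral[symmetric] power_mult_distrib del: ennreal_numeral)
      then show "ennreal (M (2 * r) / r\<^sup>2) * indicator {1..} r \<le> 4 * ?F (0 + 2 * r)"
        by (auto split: split_indicator)
    qed
    also have "\<dots> = 4 * (\<integral>\<^sup>+r. ?F (0 + 2 * r) \<partial>lborel)"
      by (rule nn_integral_cmult) measurable
    also have "\<dots> < \<infinity>"
    proof -
      have "(\<integral>\<^sup>+s. ?F s \<partial>lborel) = ennreal \<bar>2\<bar> * (\<integral>\<^sup>+r. ?F (0 + 2 * r) \<partial>lborel)"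
        by (rule nn_integral_real_affine) auto
      with finM have "(\<integral>\<^sup>+r. ?F (0 + 2 * r) \<partial>lborel) < \<infinity>"
        by (auto simp: ennreal_mult_less_top)
      then show ?thesis
        by (simp add: ennreal_mult_less_top)
    qed
    finally show "(\<integral>\<^sup>+r. ennreal (M (2 * r) / r\<^sup>2) * indicator {1..} r \<partial>lborel) < \<infinity>" .
  qed
qed

subsection \<open>Gradients, the weight at infinity and maxima\<close>

text \<open>A Euclidean space provides a vector representing the derivative, and its uniqueness
  makes the definite description in \<open>grad\<close> denote that vector.\<close>

lemma GDERIV_grad:
  fixes u :: "'a::euclidean_space \<Rightarrow> real"
  assumes "(u has_derivative l) (at x)"
  shows "GDERIV u x :> grad u x"
proof -
  interpret bounded_linear l
    by (rule has_derivative_bounded_linear[OF assms])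
  have l: "l h = h \<bullet> (\<Sum>b\<in>Basis. l b *\<^sub>R b)" for h
  proof -
    have "l h = l (\<Sum>b\<in>Basis. (h \<bullet> b) *\<^sub>R b)"
      by (simp add: euclidean_representation)
    also have "\<dots> = (\<Sum>b\<in>Basis. (h \<bullet> b) * l b)"
      by (simp add: sum scaleR)
    also have "\<dots> = h \<bullet> (\<Sum>b\<in>Basis. l b *\<^sub>R b)"
      by (simp add: inner_sum_right mult.commute)
    finally show ?thesis .
  qed
  have ex: "GDERIV u x :> (\<Sum>b\<in>Basis. l b *\<^sub>R b)"
    unfolding gderiv_def by (rule has_derivative_eq_rhs[OF assms ext[OF l]])
  have "v = v'" if "GDERIV u x :> v" "GDERIV u x :> v'" for v v'
  proof -
    have "(\<lambda>h. h \<bullet> v) = (\<lambda>h. h \<bullet> v')"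
      using that unfolding gderiv_def by (rule has_derivative_unique)
    then have "(v - v') \<bullet> (v - v') = 0"
      by (simp add: fun_eq_iff inner_diff_right)
    then show ?thesis by simp
  qed
  with ex show ?thesis
    unfolding grad_def by (metis (mono_tags, lifting) theI)
qed

text \<open>Subtracting the quadratic function that touches \<open>u\<close> from above leaves a
  function with a maximum at \<open>x\<close>, so its derivative there vanishes.\<close>

lemma GDERIV_touching:
  fixes u :: "'a::real_inner \<Rightarrow> real"
  assumes u: "GDERIV u x :> v" and le: "\<And>h. u (x + h) - u x \<le> w \<bullet> h + C * (norm h)\<^sup>2"
  shows "v = w"
proof -
  let ?\<phi> = "\<lambda>y. u y - w \<bullet> (y - x) - C * ((y - x) \<bullet> (y - x))"
  have "(?\<phi> has_derivative (\<lambda>h. h \<bullet> v - w \<bullet> h)) (at x)"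
    using u unfolding gderiv_def by (auto intro!: derivative_eq_intros)
  moreover have "?\<phi> y \<le> ?\<phi> x" for y
    using le[of "y - x"] by (simp add: power2_norm_eq_inner)
  ultimately have "(\<lambda>h. h \<bullet> v - w \<bullet> h) = (\<lambda>h. 0)"
    by (intro differential_zero_maxmin[of x UNIV ?\<phi>]) auto
  then have "(v - w) \<bullet> v - w \<bullet> (v - w) = 0"
    by meson
  then have "(v - w) \<bullet> (v - w) = 0"
    by (simp add: inner_diff_left inner_diff_right inner_commute)
  then show ?thesis by simp
qed

lemma GDERIV_lipschitz:
  fixes u :: "'a::real_inner \<Rightarrow> real"
  assumes u: "\<And>x. GDERIV u x :> v x" and L: "\<And>x. norm (v x) \<le> L"
  shows "\<bar>u x - u y\<bar> \<le> L * norm (x - y)"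
proof -
  have "norm (u x - u y) \<le> L * norm (x - y)"
  proof (rule differentiable_bound[where S = UNIV and f' = "\<lambda>x h. h \<bullet> v x"])
    fix z
    show "(u has_derivative (\<lambda>h. h \<bullet> v z)) (at z within UNIV)"
      using u by (simp add: gderiv_def)
    have "norm (h \<bullet> v z) \<le> L * norm h" for h
      using Cauchy_Schwarz_ineq2[of h "v z"] mult_left_mono[OF L[of z] norm_ge_zero[of h]]
      by (simp add: mult.commute)
    then show "onorm (\<lambda>h. h \<bullet> v z) \<le> L"
      by (rule onorm_bound[OF order_trans[OF norm_ge_zero L]])
  qed auto
  then show ?thesis by simp
qed

lemma C1_on_strip_derivatives:
  fixes f :: "real \<Rightarrow> 'a::euclidean_space \<Rightarrow> real"
  assumes C1: "C1_on (S \<times> UNIV) (\<lambda>(t, x). f t x)" and t: "t \<in> S"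
  shows "GDERIV (f t) x :> grad (f t) x"
    and "((\<lambda>s. f s x) has_real_derivative deriv (\<lambda>s. f s x) t) (at t)"
proof -
  obtain F' where F': "((\<lambda>(t, x). f t x) has_derivative blinfun_apply (F' (t, x))) (at (t, x))"
    using C1 t unfolding C1_on_def by blast
  have "((\<lambda>y. (t, y)) has_derivative (\<lambda>h. (0, h))) (at x)"
    by (auto intro!: derivative_eq_intros)
  from has_derivative_compose[OF this F']
  have "(f t has_derivative (\<lambda>h. F' (t, x) (0, h))) (at x)"
    by simp
  then show "GDERIV (f t) x :> grad (f t) x"
    by (rule GDERIV_grad)
  have "((\<lambda>s. (s, x)) has_derivative (\<lambda>h. (h, 0))) (at t)"
    by (auto intro!: derivative_eq_intros)
  from has_derivative_compose[OF this F']
  have "((\<lambda>s. f s x) has_derivative (\<lambda>h. F' (t, x) (h, 0))) (at t)"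
    by simp
  then have "(\<lambda>s. f s x) field_differentiable at t"
    by (metis differentiable_def real_differentiableE field_differentiable_def)
  then show "((\<lambda>s. f s x) has_real_derivative deriv (\<lambda>s. f s x) t) (at t)"
    by (rule field_differentiable_derivI)
qed

lemma C1_on_imp_continuous_on:
  assumes "C1_on S F"
  shows "continuous_on S F"
proof -
  obtain F' where "\<forall>z\<in>S. (F has_derivative blinfun_apply (F' z)) (at z)"
    using assms unfolding C1_on_def by blast
  then show ?thesis
    by (intro continuous_at_imp_continuous_on ballI) (metis has_derivative_continuous)
qed

section \<open>The Japanese bracket, a smooth weight penalising infinity\<close>

definition bracket :: "'a::real_inner \<Rightarrow> real" where
  "bracket x = sqrt (1 + (norm x)\<^sup>2)"

lemma bracket_ge_1: "bracket x \<ge> 1"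
  by (simp add: bracket_def)

lemma bracket_ge_norm: "norm x \<le> bracket x"
  by (simp add: bracket_def real_le_rsqrt)

lemma bracket_squared: "(bracket x)\<^sup>2 = 1 + (norm x)\<^sup>2"
  by (simp add: bracket_def)

lemma bracket_lipschitz:
  fixes x h :: "'a::real_inner"
  shows "\<bar>bracket (x + h) - bracket x\<bar> \<le> norm h"
proof -
  have le: "bracket (x + h) \<le> bracket x + norm h" for x h :: 'a
  proof -
    have "norm (x + h) \<le> norm x + norm h"
      by (rule norm_triangle_ineq)
    then have "(norm (x + h))\<^sup>2 \<le> (norm x + norm h)\<^sup>2"
      by (intro power_mono) auto
    moreover have "norm x * norm h \<le> bracket x * norm h"
      by (intro mult_right_mono bracket_ge_norm) auto
    ultimately have "(bracket (x + h))\<^sup>2 \<le> (bracket x + norm h)\<^sup>2"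
      unfolding power2_sum bracket_squared by simp
    then show ?thesis
      by (rule power2_le_imp_le) (use bracket_ge_1[of x] in simp)
  qed
  from le[of x h] le[of "x + h" "- h"] show ?thesis by simp
qed

text \<open>Apply \<open>2 a b \<le> a^2 + b^2\<close> to the brackets \<open>a\<close> of
  \<open>x\<close> and \<open>b\<close> of \<open>x + h\<close>. The square of the latter expands
  exactly, and dividing by \<open>2 a\<close> gives the claim because
  \<open>a \<ge> 1\<close>.\<close>

lemma bracket_second_order:
  fixes x h :: "'a::real_inner"
  shows "bracket (x + h) - bracket x - (x /\<^sub>R bracket x) \<bullet> h \<le> (norm h)\<^sup>2"
proof -
  let ?b = "bracket x"
  have b: "?b \<ge> 1" by (rule bracket_ge_1)
  have sq: "(bracket (x + h))\<^sup>2 = ?b\<^sup>2 + 2 * (x \<bullet> h) + (norm h)\<^sup>2"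
    unfolding bracket_squared by (simp add: power2_norm_eq_inner inner_add_left inner_add_right inner_commute)
  have "2 * ?b * bracket (x + h) \<le> ?b\<^sup>2 + (bracket (x + h))\<^sup>2"
    using sum_squares_bound[of ?b "bracket (x + h)"] by simp
  then have "2 * ?b * (bracket (x + h) - ?b) - 2 * (x \<bullet> h) \<le> (norm h)\<^sup>2"
    unfolding sq by (simp add: power2_eq_square algebra_simps)
  also have "\<dots> \<le> 2 * ?b * (norm h)\<^sup>2"
    using mult_right_mono[of 1 "2 * ?b" "(norm h)\<^sup>2"] b by simp
  also have "x \<bullet> h = ?b * ((x /\<^sub>R ?b) \<bullet> h)"
    using b by simp
  finally have "2 * ?b * (bracket (x + h) - ?b - (x /\<^sub>R ?b) \<bullet> h) \<le> 2 * ?b * (norm h)\<^sup>2"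
    by (simp only: right_diff_distrib mult.assoc)
  then show ?thesis
    using b by simp
qed

lemma norm_bracket_gradient: "norm (x /\<^sub>R bracket x) \<le> 1"
  using bracket_ge_norm[of x] bracket_ge_1[of x] by (simp add: divide_simps abs_of_pos)

section \<open>Attained maxima and the one-sided condition in time\<close>

lemma continuous_attains_sup_coercive:
  fixes \<Phi> :: "'a::heine_borel \<Rightarrow> real"
  assumes S: "closed S" and cont: "continuous_on S \<Phi>" and z: "z \<in> S" "\<Phi> z > 0"
    and coercive: "\<And>y. y \<in> S \<Longrightarrow> \<Phi> y > 0 \<Longrightarrow> y \<in> B" and B: "compact B"
  obtains y where "y \<in> S" "\<And>w. w \<in> S \<Longrightarrow> \<Phi> w \<le> \<Phi> y" "\<Phi> y > 0"
proof -
  have "compact (S \<inter> B)"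
    using S B by (simp add: closed_Int_compact)
  moreover have "z \<in> S \<inter> B"
    using z coercive by auto
  ultimately obtain y where y: "y \<in> S \<inter> B" "\<forall>w\<in>S \<inter> B. \<Phi> w \<le> \<Phi> y"
    using continuous_attains_sup[of "S \<inter> B" \<Phi>] continuous_on_subset[OF cont] by blast
  then have "\<Phi> y > 0"
    using z \<open>z \<in> S \<inter> B\<close> by force
  \<comment> \<open>Points of \<open>S\<close> outside \<open>B\<close> have nonpositive value,
    hence lie below the positive maximum over the compact part.\<close>
  moreover have "\<Phi> w \<le> \<Phi> y" if "w \<in> S" for w
    using coercive[OF that] y(2) that \<open>\<Phi> y > 0\<close> by fastforce
  ultimately show thesis
    using that y(1) by blast
qed

text \<open>Only earlier times are compared, because the maximum may sit at the final time of the
  slab.\<close>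

lemma DERIV_nonneg_at_right_max:
  fixes \<phi> :: "real \<Rightarrow> real"
  assumes d: "(\<phi> has_real_derivative D) (at t)" and "a < t" and max: "\<And>s. a \<le> s \<Longrightarrow> s \<le> t \<Longrightarrow> \<phi> s \<le> \<phi> t"
  shows "D \<ge> 0"
proof (rule ccontr)
  assume "\<not> D \<ge> 0"
  then obtain e where e: "e > 0" "\<And>h. h > 0 \<Longrightarrow> h < e \<Longrightarrow> \<phi> t < \<phi> (t - h)"
    using DERIV_neg_dec_left[OF d] by auto
  have "\<phi> t < \<phi> (t - min (e / 2) (t - a))"
    using e(1) \<open>a < t\<close> by (intro e(2)) auto
  moreover have "\<phi> (t - min (e / 2) (t - a)) \<le> \<phi> t"
    using e(1) \<open>a < t\<close> by (intro max) auto
  ultimately show False by simp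
qed

subsection \<open>Comparison\<close>

text \<open>The maximum is used along three families of displacements. Moving \<open>x\<close> alone
  bounds increments of \<open>u\<close> from above by a quadratic, moving \<open>y\<close> alone
  bounds those of \<open>w\<close> from below, and moving both equally cancels the quadratic penalty
  and orders the two increments. These are the inputs of \<open>kern_diff_le\<close>.\<close>

lemma space_max_pv_diff_le:
  fixes u w :: "real^'n \<Rightarrow> real" and N :: "real \<Rightarrow> real"
  defines "d \<equiv> real (CARD('n) + 1)"
  assumes du: "\<And>z. GDERIV u z :> grad u z" and dw: "\<And>z. GDERIV w z :> grad w z"
    and Lu: "\<And>z. norm (grad u z) \<le> L" and Lw: "\<And>z. norm (grad w z) \<le> L"
    and E: "E \<ge> 0" and k: "k \<ge> 0" and LE: "(2 * d - 1) * (L + 2 * E)\<^sup>2 \<le> 1"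
    and max: "\<And>h h'. u (x + h) - w (y + h') - k * (norm (x + h - (y + h')))\<^sup>2 - E * bracket (x + h)
        \<le> u x - w y - k * (norm (x - y))\<^sup>2 - E * bracket x"
    and I: "has_pv_integral (muskat_integrand u x) x I"
    and J: "has_pv_integral (muskat_integrand w y) y J"
    and far: "\<And>h. R \<le> norm h \<Longrightarrow> \<bar>u (x + h) - u x\<bar> \<le> N (norm h)"
      "\<And>h. R \<le> norm h \<Longrightarrow> \<bar>w (y + h) - w y\<bar> \<le> N (norm h)"
    and N: "\<And>r. N r \<ge> 0" "N \<in> borel_measurable borel"
      "(\<integral>\<^sup>+r. ennreal (N r / r\<^sup>2) * indicator {R..} r \<partial>lborel) \<le> ennreal \<tau>"
    and R: "R > 0" and \<tau>: "\<tau> \<ge> 0"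
  shows "I - J \<le> unit_ball_vol CARD('n) * CARD('n) * (E * (2 + 2 * d + k * d) * R + 2 * (1 + d) * \<tau>)"
proof -
  \<comment> \<open>Here \<open>p\<close> is the gradient of the quadratic penalty in
    \<open>x\<close> and \<open>e\<close> that of the weight. At the maximum the gradients turn out
    to be \<open>p + e\<close> and \<open>p\<close>, so they differ by at most \<open>E\<close>;
    \<open>D h\<close> is the exact increment that \<open>e\<close> linearises.\<close>
  define p where "p = (2 * k) *\<^sub>R (x - y)"
  define e where "e = E *\<^sub>R (x /\<^sub>R bracket x)"
  define D where "D h = E * (bracket (x + h) - bracket x)" for h
  have d: "d \<ge> 1" by (simp add: d_def)
  have L: "L \<ge> 0" by (rule order_trans[OF norm_ge_zero Lu])
  have A: "u (x + h) - u x - D h \<le> p \<bullet> h + k * (norm h)\<^sup>2" for h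
  proof -
    have "(norm (x + h - y))\<^sup>2 = (norm (x - y))\<^sup>2 + 2 * ((x - y) \<bullet> h) + (norm h)\<^sup>2"
      by (simp add: power2_norm_eq_inner inner_add_left inner_add_right inner_diff_left inner_diff_right inner_commute)
    then have "k * (norm (x + h - y))\<^sup>2 = k * (norm (x - y))\<^sup>2 + p \<bullet> h + k * (norm h)\<^sup>2"
      by (simp only: p_def inner_scaleR_left distrib_left right_diff_distrib mult.assoc mult.left_commute)
    then show ?thesis
      using max[of h 0] by (simp add: D_def algebra_simps)
  qed
  have B: "p \<bullet> h - k * (norm h)\<^sup>2 \<le> w (y + h) - w y" for h
  proof -
    have "(norm (x - (y + h)))\<^sup>2 = (norm (x - y))\<^sup>2 - 2 * ((x - y) \<bullet> h) + (norm h)\<^sup>2"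
      by (simp add: power2_norm_eq_inner inner_add_left inner_add_right inner_diff_left inner_diff_right inner_commute)
    then have "k * (norm (x - (y + h)))\<^sup>2 = k * (norm (x - y))\<^sup>2 - p \<bullet> h + k * (norm h)\<^sup>2"
      by (simp only: p_def inner_scaleR_left distrib_left right_diff_distrib mult.assoc mult.left_commute)
    then show ?thesis
      using max[of 0 h] by (simp add: algebra_simps)
  qed
  have AB: "u (x + h) - u x \<le> w (y + h) - w y + D h" for h
    using max[of h h] by (simp add: D_def algebra_simps)
  have De: "D h - e \<bullet> h \<le> E * (norm h)\<^sup>2" for h
    using mult_left_mono[OF bracket_second_order[of x h] E] by (simp add: D_def e_def right_diff_distrib)
  have DE: "\<bar>D h\<bar> \<le> E * norm h" for h
    using mult_left_mono[OF bracket_lipschitz[of x h] E] E by (simp add: D_def abs_mult)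
  have eE: "norm e \<le> E"
    using mult_left_mono[OF norm_bracket_gradient[of x] E] E by (simp add: e_def abs_mult mult.assoc)
  have gu: "grad u x = p + e"
  proof (rule GDERIV_touching[OF du])
    show "u (x + h) - u x \<le> (p + e) \<bullet> h + (k + E) * (norm h)\<^sup>2" for h
      using A[of h] De[of h] by (simp add: inner_add_left distrib_right)
  qed
  have gw: "grad w y = p"
  proof -
    have "- grad w y = - p"
    proof (rule GDERIV_touching[OF GDERIV_minus[OF dw]])
      show "- w (y + h) - - w y \<le> - p \<bullet> h + k * (norm h)\<^sup>2" for h
        using B[of h] by simp
    qed
    then show ?thesis by simp
  qed
  have inner_le: "\<bar>v \<bullet> h\<bar> \<le> c * norm h" if "norm v \<le> c" for v h :: "real^'n" and c
    using Cauchy_Schwarz_ineq2[of v h] mult_right_mono[OF that norm_ge_zero[of h]] by linarith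
  have lip: "\<bar>u (x + h) - u x\<bar> \<le> L * norm h" "\<bar>w (y + h) - w y\<bar> \<le> L * norm h" for h
    using GDERIV_lipschitz[OF du Lu, of "x + h" x] GDERIV_lipschitz[OF dw Lw, of "y + h" y] by simp_all
  have L1: "L \<le> 1"
  proof -
    have "L\<^sup>2 \<le> (L + 2 * E)\<^sup>2"
      using L E by (intro power_mono) auto
    also have "\<dots> \<le> (2 * d - 1) * (L + 2 * E)\<^sup>2"
      using mult_right_mono[of 1 "2 * d - 1" "(L + 2 * E)\<^sup>2"] d by simp
    finally have "L\<^sup>2 \<le> 1\<^sup>2"
      using LE by simp
    then show ?thesis
      by (rule power2_le_imp_le) simp
  qed
  show ?thesis
  proof (rule muskat_pv_diff_le[OF I J _ _ _ far N R _ \<tau>, folded d_def])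
    show "norm (grad u x) \<le> 1" "norm (grad w y) \<le> 1"
      using Lu Lw L1 by (meson order_trans)+
    show "E * (2 + 2 * d + k * d) \<ge> 0"
      using E k d by simp
    fix h :: "real^'n" assume h: "h \<noteq> 0"
    have m: "\<bar>p \<bullet> h\<bar> \<le> L * norm h" "\<bar>p \<bullet> h + e \<bullet> h\<bar> \<le> L * norm h" "\<bar>e \<bullet> h\<bar> \<le> E * norm h"
      using inner_le[OF Lw[of y], of h] inner_le[OF Lu[of x], of h] inner_le[OF eE, of h]
      by (simp_all add: gu gw inner_add_left)
    have "kern d (norm h) (u (x + h) - u x) (p \<bullet> h + e \<bullet> h) - kern d (norm h) (w (y + h) - w y) (p \<bullet> h)
        \<le> E * (2 + 2 * d + k * d) * norm h powr (2 - d)"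
      by (rule kern_diff_le[OF _ d L E k LE m lip DE[of h] De[of h] AB[of h] A[of h] B[of h]]) (use h in simp)
    then show "kern d (norm h) (u (x + h) - u x) (grad u x \<bullet> h) - kern d (norm h) (w (y + h) - w y) (grad w y \<bullet> h)
        \<le> E * (2 + 2 * d + k * d) * norm h powr (2 - d)"
      by (simp only: gu gw inner_add_left)
  qed
qed

section \<open>Doubling of variables on a slab of interior times\<close>

lemma muskat_classical_C1:
  assumes "muskat_classical rel T f"
  shows "C1_on ({0<..<T} \<times> UNIV) (\<lambda>(t, x). f t x)"
  using assms unfolding muskat_classical_def by (elim conjE)

lemma muskat_classical_equation:
  assumes "muskat_classical rel T f" and "t \<in> {0<..<T}"
  obtains I where "has_pv_integral (muskat_integrand (f t) x) x I" "rel (deriv (\<lambda>s. f s x) t) I"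
proof -
  have "\<forall>t\<in>{0<..<T}. \<forall>x. \<exists>I. has_pv_integral (muskat_integrand (f t) x) x I \<and> rel (deriv (\<lambda>s. f s x) t) I"
    using assms(1) unfolding muskat_classical_def by (elim conjE)
  with assms(2) that show thesis by blast
qed

lemma le_of_small_multiples:
  fixes A B C :: real
  assumes C: "C \<ge> 0" and c: "c > 0" and le: "\<And>\<epsilon>. 0 < \<epsilon> \<Longrightarrow> \<epsilon> < c \<Longrightarrow> A \<le> B + \<epsilon> * C"
  shows "A \<le> B"
proof (rule field_le_epsilon)
  fix e :: real assume e: "e > 0"
  \<comment> \<open>Adding 1 to \<open>C\<close> avoids a zero denominator, and halving
    \<open>c\<close> keeps the choice strictly below \<open>c\<close>.\<close>
  define \<epsilon> where "\<epsilon> = min (c / 2) (e / (C + 1))"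
  have "\<epsilon> * C \<le> e / (C + 1) * (C + 1)"
    using C e by (intro mult_mono) (auto simp: \<epsilon>_def)
  then have "\<epsilon> * C \<le> e"
    using C by simp
  moreover have "A \<le> B + \<epsilon> * C"
    using c e C by (intro le) (auto simp: \<epsilon>_def)
  ultimately show "A \<le> B + e" by linarith
qed

text \<open>Both \<open>\<mu>\<close> and \<open>\<epsilon>\<^sub>0\<close> are fixed before
  \<open>\<epsilon>\<close>, so \<open>\<epsilon>\<close> may tend to 0 with the other parameters
  held. The weight carries an exponential in time because the near field produces an error
  proportional to the weight itself.\<close>

lemma penalised_comparison:
  fixes f g :: "real \<Rightarrow> real^'n \<Rightarrow> real"
  defines "d \<equiv> real (CARD('n) + 1)"
  assumes f: "muskat_classical (\<le>) T f" and g: "muskat_classical (\<ge>) T g"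
    and Lf: "\<And>t x. t \<in> {0<..<T} \<Longrightarrow> norm (grad (f t) x) \<le> L"
    and Lg: "\<And>t x. t \<in> {0<..<T} \<Longrightarrow> norm (grad (g t) x) \<le> L"
    and L: "L < 1 / sqrt (2 * d - 1)"
    and ab: "0 < a" "a \<le> b" "b < T"
    and init: "\<And>x. f a x \<le> g a x + \<eta>"
    and k: "k \<ge> 1" and \<kappa>: "\<kappa> > 0"
  obtains \<mu> \<epsilon>\<^sub>0 where "\<epsilon>\<^sub>0 > 0"
    "\<And>\<epsilon> t x. 0 < \<epsilon> \<Longrightarrow> \<epsilon> < \<epsilon>\<^sub>0 \<Longrightarrow> t \<in> {a..b} \<Longrightarrow>
       f t x \<le> g t x + \<eta> + 1 / k + \<kappa> * (t - a) + \<epsilon> * (exp (\<mu> * (t - a)) * bracket x)"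
proof -
  define c where "c = unit_ball_vol CARD('n) * CARD('n)"
  have c: "c > 0" by (simp add: c_def)
  have d: "d \<ge> 1" by (simp add: d_def)
  have sub: "t \<in> {0<..<T}" if "t \<in> {a..b}" for t
    using that ab by auto
  have L0: "L \<ge> 0"
    by (rule order_trans[OF norm_ge_zero Lf[of a 0]]) (use ab in auto)
  \<comment> \<open>\<open>L + 2 * s\<close> is exactly the critical slope, so \<open>s\<close> is
    the largest slope of the weight for which monotonicity of the kernel survives.\<close>
  define s where "s = (1 / sqrt (2 * d - 1) - L) / 2"
  have s: "s > 0" using L by (simp add: s_def)
  have small: "(2 * d - 1) * (L + 2 * E)\<^sup>2 \<le> 1" if "0 \<le> E" "E \<le> s" for E
  proof -
    have "(L + 2 * E)\<^sup>2 \<le> (1 / sqrt (2 * d - 1))\<^sup>2"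
      using that L0 by (intro power_mono) (auto simp: s_def)
    also have "\<dots> = 1 / (2 * d - 1)"
      using d by (simp add: power_divide)
    finally show ?thesis
      using d by (simp add: field_simps)
  qed
  have L1: "L \<le> 1"
  proof -
    have "1 / sqrt (2 * d - 1) \<le> 1"
      using d by simp
    with L show ?thesis by linarith
  qed
  have df: "GDERIV (f t) x :> grad (f t) x" "((\<lambda>s. f s x) has_real_derivative deriv (\<lambda>s. f s x) t) (at t)"
    and dg: "GDERIV (g t) x :> grad (g t) x" "((\<lambda>s. g s x) has_real_derivative deriv (\<lambda>s. g s x) t) (at t)"
    if "t \<in> {a..b}" for t x
    using C1_on_strip_derivatives[OF muskat_classical_C1[OF f] sub[OF that]]
      C1_on_strip_derivatives[OF muskat_classical_C1[OF g] sub[OF that]] by blast+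
  have lip_g: "\<bar>g t x - g t y\<bar> \<le> norm (x - y)" if "t \<in> {a..b}" for t x y
    using GDERIV_lipschitz[OF dg(1)[OF that] Lg[OF sub[OF that]], of x y]
      mult_right_mono[OF L1 norm_ge_zero[of "x - y"]] by linarith
  have cont_f: "continuous_on ({0<..<T} \<times> UNIV) (\<lambda>(t, x). f t x)"
    and cont_g: "continuous_on ({0<..<T} \<times> UNIV) (\<lambda>(t, x). g t x)"
    by (rule C1_on_imp_continuous_on[OF muskat_classical_C1[OF f]],
        rule C1_on_imp_continuous_on[OF muskat_classical_C1[OF g]])
  obtain Nf where Nf: "mono Nf" "\<And>r. Nf r \<ge> 0"
    "\<And>t h r. t \<in> {a..b} \<Longrightarrow> norm h < 2 * r \<Longrightarrow> \<bar>f t h - f t 0\<bar> \<le> Nf r"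
    "(\<integral>\<^sup>+r. ennreal (Nf r / r\<^sup>2) * indicator {1..} r \<partial>lborel) < \<infinity>"
    using muskat_growth[OF f ab(1,3)] by blast
  obtain Ng where Ng: "mono Ng" "\<And>r. Ng r \<ge> 0"
    "\<And>t h r. t \<in> {a..b} \<Longrightarrow> norm h < 2 * r \<Longrightarrow> \<bar>g t h - g t 0\<bar> \<le> Ng r"
    "(\<integral>\<^sup>+r. ennreal (Ng r / r\<^sup>2) * indicator {1..} r \<partial>lborel) < \<infinity>"
    using muskat_growth[OF g ab(1,3)] by blast
  \<comment> \<open>One profile serves both functions; the factor 2 pays for the triangle inequality
    through the value at the origin.\<close>
  define N where "N r = 2 * (Nf r + Ng r)" for r
  have N_mono: "mono N"
    using monoD[OF Nf(1)] monoD[OF Ng(1)] unfolding N_def by (intro monoI mult_left_mono add_mono) auto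
  have N0: "N r \<ge> 0" for r
    using Nf(2) Ng(2) by (simp add: N_def)
  have [measurable]: "N \<in> borel_measurable borel" "Nf \<in> borel_measurable borel" "Ng \<in> borel_measurable borel"
    using N_mono Nf(1) Ng(1) by (auto intro: borel_measurable_mono)
  have N_fin: "(\<integral>\<^sup>+r. ennreal (N r / r\<^sup>2) * indicator {1..} r \<partial>lborel) < \<infinity>"
  proof -
    have "ennreal (N r / r\<^sup>2) = 2 * (ennreal (Nf r / r\<^sup>2) + ennreal (Ng r / r\<^sup>2))" for r
      using Nf(2)[of r] Ng(2)[of r]
      by (simp add: N_def ennreal_plus[symmetric] ennreal_mult[symmetric] ennreal_numeral[symmetric]
          add_divide_distrib del: ennreal_plus ennreal_numeral)
    then have "(\<integral>\<^sup>+r. ennreal (N r / r\<^sup>2) * indicator {1..} r \<partial>lborel)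
        = (\<integral>\<^sup>+r. 2 * (ennreal (Nf r / r\<^sup>2) * indicator {1..} r + ennreal (Ng r / r\<^sup>2) * indicator {1..} r) \<partial>lborel)"
      by (intro nn_integral_cong) (auto split: split_indicator)
    also have "\<dots> = 2 * ((\<integral>\<^sup>+r. ennreal (Nf r / r\<^sup>2) * indicator {1..} r \<partial>lborel)
        + (\<integral>\<^sup>+r. ennreal (Ng r / r\<^sup>2) * indicator {1..} r \<partial>lborel))"
      by (simp add: nn_integral_cmult nn_integral_add)
    finally show ?thesis
      using Nf(4) Ng(4) by (simp add: ennreal_mult_less_top)
  qed
  \<comment> \<open>Makes the far field cost exactly \<open>\<kappa> / 2\<close>, half of the linear
    penalty in time.\<close>
  define \<tau> where "\<tau> = \<kappa> / (4 * (1 + d) * c)"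
  have \<tau>: "\<tau> > 0" using \<kappa> c d by (simp add: \<tau>_def)
  obtain R\<^sub>0 where R\<^sub>0: "R\<^sub>0 \<ge> 1"
    "\<And>R. R \<ge> R\<^sub>0 \<Longrightarrow> (\<integral>\<^sup>+r. ennreal (N r / r\<^sup>2) * indicator {R..} r \<partial>lborel) \<le> ennreal \<tau>"
    by (rule nn_integral_tail_le[OF _ N_fin, of "ennreal \<tau>"]) (use \<tau> in auto)
  \<comment> \<open>The radius used below is \<open>R\<^sub>0 + 2 + norm x\<close>, at most
    \<open>(R\<^sub>0 + 3) * bracket x\<close>; this \<open>\<mu>\<close> lets the time derivative
    of the weight absorb the near field.\<close>
  define \<mu> where "\<mu> = c * (2 + 2 * d + k * d) * (R\<^sub>0 + 3)"
  have \<mu>: "\<mu> \<ge> 0" using c d k R\<^sub>0(1) by (simp add: \<mu>_def)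
  \<comment> \<open>Keeps \<open>\<epsilon> * exp (\<mu> * (t - a))\<close> at most \<open>s\<close>
    up to time \<open>b\<close>.\<close>
  define \<epsilon>\<^sub>0 where "\<epsilon>\<^sub>0 = s / exp (\<mu> * (b - a))"
  have "bdd_above ((\<lambda>t. f t 0 - g t 0) ` {a..b})"
  proof (intro bounded_imp_bdd_above compact_imp_bounded compact_continuous_image continuous_intros)
    have *: "continuous_on {a..b} (\<lambda>t. (t, 0 :: real^'n))"
      by (intro continuous_intros)
    show "continuous_on {a..b} (\<lambda>t. f t 0)" "continuous_on {a..b} (\<lambda>t. g t 0)"
      using continuous_on_compose2[OF cont_f *] continuous_on_compose2[OF cont_g *] sub by force+
  qed auto
  then obtain C0 where C0: "\<And>t. t \<in> {a..b} \<Longrightarrow> f t 0 - g t 0 \<le> C0"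
    unfolding bdd_above_def by blast
  \<comment> \<open>The first bound lets \<open>1 / k\<close> pay for doubling the variables at the
    initial time; the second gives coercivity in \<open>x - y\<close>.\<close>
  have quad: "r - k * r\<^sup>2 \<le> 1 / k" "r - k * r\<^sup>2 \<le> 1 - r" for r
  proof -
    have "0 \<le> (2 * k * r - 1)\<^sup>2 + 3"
      by simp
    then have "0 \<le> ((2 * k * r - 1)\<^sup>2 + 3) / (4 * k)"
      using k by simp
    also have "\<dots> = k * r\<^sup>2 - r + 1 / k"
      using k by (simp add: field_simps power2_eq_square)
    finally show "r - k * r\<^sup>2 \<le> 1 / k" by simp
    have "0 \<le> (r - 1)\<^sup>2 + (k - 1) * r\<^sup>2"
      using k by simp
    then show "r - k * r\<^sup>2 \<le> 1 - r"
      by (simp add: power2_eq_square algebra_simps)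
  qed
  have main: "f t x \<le> g t y + k * (norm (x - y))\<^sup>2 + \<epsilon> * (exp (\<mu> * (t - a)) * bracket x) + \<eta> + 1 / k + \<kappa> * (t - a)"
    if \<epsilon>: "0 < \<epsilon>" "\<epsilon> < \<epsilon>\<^sub>0" and t: "t \<in> {a..b}" for \<epsilon> t x y
  proof (rule ccontr)
    assume contra: "\<not> ?thesis"
    define \<Phi> where "\<Phi> = (\<lambda>(t, x, y). f t x - g t y - k * (norm (x - y))\<^sup>2
        - \<epsilon> * (exp (\<mu> * (t - a)) * bracket x) - \<eta> - 1 / k - \<kappa> * (t - a))"
    let ?S = "{a..b} \<times> (UNIV :: (real^'n) set) \<times> (UNIV :: (real^'n) set)"
    obtain C1 where C1: "C1 \<ge> 0" "\<And>r. r \<ge> 0 \<Longrightarrow> N r \<le> \<epsilon> / 2 * r + C1"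
      using sublinear_growth[OF N_mono N0 N_fin, of "\<epsilon> / 2"] \<epsilon>(1) by auto
    define C where "C = \<epsilon> / 2 + C1 + \<bar>C0\<bar> + \<bar>\<eta>\<bar> + 1"
    have C: "C \<ge> 0" using C1 \<epsilon> by (simp add: C_def)
    \<comment> \<open>Sublinear growth of the difference costs
      \<open>\<epsilon> / 2 * norm x\<close>, while the weight subtracts at least
      \<open>\<epsilon> * norm x\<close>. The surplus confines \<open>x\<close>, and the second
      bound of \<open>quad\<close> confines \<open>x - y\<close>.\<close>
    have coercive: "\<epsilon> / 2 * norm x + norm (x - y) \<le> C" if "t \<in> {a..b}" "\<Phi> (t, x, y) > 0" for t x y
    proof -
      have t: "t \<in> {a..b}" by (rule that(1))
      have "norm x < 2 * (norm x + 1)"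
        by (smt (verit) norm_ge_zero)
      from Nf(3)[OF t this] Ng(3)[OF t this]
      have "(f t x - f t 0) - (g t x - g t 0) \<le> N (norm x + 1)"
        using Nf(2)[of "norm x + 1"] Ng(2)[of "norm x + 1"] by (simp add: N_def abs_le_iff)
      also have "\<dots> \<le> \<epsilon> / 2 * (norm x + 1) + C1"
        by (rule C1(2)) simp
      finally have 1: "(f t x - f t 0) - (g t x - g t 0) \<le> \<epsilon> / 2 * norm x + \<epsilon> / 2 + C1"
        by (simp only: distrib_left mult_1_right)
      have "1 * norm x \<le> exp (\<mu> * (t - a)) * bracket x"
        using t \<mu> bracket_ge_norm[of x] by (intro mult_mono) auto
      from mult_left_mono[OF this, of \<epsilon>] \<epsilon> have 2: "\<epsilon> * norm x \<le> \<epsilon> * (exp (\<mu> * (t - a)) * bracket x)"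
        by simp
      have 3: "\<kappa> * (t - a) \<ge> 0" "1 / k \<ge> 0"
        using t \<kappa> k by auto
      have "g t x - g t y \<le> norm (x - y)"
        using lip_g[OF t, of x y] by linarith
      then show ?thesis
        using that(2) 1 2 3 C0[OF t] quad(2)[of "norm (x - y)"] abs_ge_self[of C0] abs_ge_minus_self[of \<eta>]
        unfolding \<Phi>_def C_def prod.case by linarith
    qed
    define X where "X = 2 * C / \<epsilon>"
    have cont: "continuous_on ?S \<Phi>"
    proof -
      have *: "continuous_on ?S (\<lambda>(t, x, y). (t, x))" "continuous_on ?S (\<lambda>(t, x, y). (t, y))"
        unfolding case_prod_unfold by (intro continuous_intros)+
      have "continuous_on ?S (\<lambda>(t, x, y). f t x)" "continuous_on ?S (\<lambda>(t, x, y). g t y)"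
        using continuous_on_compose2[OF cont_f *(1)] continuous_on_compose2[OF cont_g *(2)] sub
        by (force simp: case_prod_unfold)+
      then show ?thesis
        unfolding \<Phi>_def bracket_def case_prod_unfold by (intro continuous_intros) auto
    qed
    have closed: "closed ?S"
      by (intro closed_Times) auto
    have start: "(t, x, y) \<in> ?S" "\<Phi> (t, x, y) > 0"
      using t contra by (auto simp: \<Phi>_def)
    have bounded: "z \<in> {a..b} \<times> cball 0 X \<times> cball 0 (X + C)" if "z \<in> ?S" "\<Phi> z > 0" for z
    proof -
      obtain t x y where z: "z = (t, x, y)" by (cases z)
      then have t: "t \<in> {a..b}" and le: "\<epsilon> / 2 * norm x + norm (x - y) \<le> C"
        using that coercive by auto
      have "\<epsilon> / 2 * norm x \<le> C"
        using le norm_ge_zero[of "x - y"] by linarith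
      then have x: "norm x \<le> X"
        using \<epsilon> by (simp add: X_def field_simps)
      have "norm (x - y) \<le> C"
        using le mult_nonneg_nonneg[of "\<epsilon> / 2" "norm x"] \<epsilon>(1) norm_ge_zero[of x] by linarith
      moreover have "norm y \<le> norm x + norm (x - y)"
        using norm_triangle_ineq4[of x "x - y"] by simp
      ultimately show ?thesis
        using x t by (simp add: z)
    qed
    have compact: "compact ({a..b} \<times> cball (0 :: real^'n) X \<times> cball (0 :: real^'n) (X + C))"
      by (intro compact_Times) auto
    obtain z where z: "z \<in> ?S" "\<And>w. w \<in> ?S \<Longrightarrow> \<Phi> w \<le> \<Phi> z" "\<Phi> z > 0"
      using continuous_attains_sup_coercive[OF closed cont start bounded compact] by blast
    obtain t x y where txy: "z = (t, x, y)" by (cases z)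
    have t: "t \<in> {a..b}" and pos: "\<Phi> (t, x, y) > 0"
      using z txy by auto
    have max: "\<Phi> (t', x', y') \<le> \<Phi> (t, x, y)" if "t' \<in> {a..b}" for t' x' y'
      using z(2)[of "(t', x', y')"] that by (simp add: txy)
    \<comment> \<open>At time \<open>a\<close> the initial ordering, the Lipschitz bound on
      \<open>g\<close> and the first bound of \<open>quad\<close> would make \<open>\<Phi>\<close>
      nonpositive.\<close>
    have "t \<noteq> a"
    proof
      assume "t = a"
      moreover have "\<epsilon> * bracket x \<ge> 0"
        using \<epsilon> bracket_ge_1[of x] by simp
      moreover have "g a x - g a y \<le> norm (x - y)"
        using lip_g[of a x y] ab by auto
      ultimately show False
        using pos init[of x] quad(1)[of "norm (x - y)"] by (simp add: \<Phi>_def)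
    qed
    with t have ta: "a < t" by simp
    define E where "E = \<epsilon> * exp (\<mu> * (t - a))"
    have E0: "E \<ge> 0" using \<epsilon> by (simp add: E_def)
    have Es: "E \<le> s"
    proof -
      have "E \<le> \<epsilon>\<^sub>0 * exp (\<mu> * (b - a))"
        unfolding E_def using \<epsilon> \<mu> t by (intro mult_mono) (auto intro: mult_left_mono)
      then show ?thesis by (simp add: \<epsilon>\<^sub>0_def)
    qed
    \<comment> \<open>The radius depends on the unknown position \<open>x\<close>. As
      \<open>y\<close> is within distance 1 of \<open>x\<close>, a displacement of length at least
      \<open>R\<close> is longer than both \<open>x\<close> and \<open>y\<close>, so the growth
      bounds around the origin apply.\<close>
    define R where "R = R\<^sub>0 + 2 + norm x"
    have R: "R > 0" "R \<ge> R\<^sub>0"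
      using R\<^sub>0(1) unfolding R_def by (smt (verit) norm_ge_zero)+
    \<comment> \<open>Comparing the maximum with the diagonal point \<open>(t, x, x)\<close> bounds
      the quadratic penalty by an increment of \<open>g\<close>.\<close>
    have xy: "norm (x - y) \<le> 1"
    proof -
      have "k * (norm (x - y))\<^sup>2 \<le> g t x - g t y"
        using max[OF t, of x x] by (simp add: \<Phi>_def)
      then have "k * (norm (x - y))\<^sup>2 \<le> norm (x - y)"
        using lip_g[OF t, of x y] by linarith
      moreover have "1 * (norm (x - y))\<^sup>2 \<le> k * (norm (x - y))\<^sup>2"
        using k by (intro mult_right_mono) auto
      ultimately have "norm (x - y) * norm (x - y) \<le> norm (x - y) * 1"
        by (simp add: power2_eq_square)
      then show ?thesis
        by (cases "x = y") auto
    qed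
    obtain I where I: "has_pv_integral (muskat_integrand (f t) x) x I" "deriv (\<lambda>s. f s x) t \<le> I"
      using muskat_classical_equation[OF f sub[OF t]] by blast
    obtain J where J: "has_pv_integral (muskat_integrand (g t) y) y J" "deriv (\<lambda>s. g s y) t \<ge> J"
      using muskat_classical_equation[OF g sub[OF t]] by blast
    have far: "norm x < norm h" "norm y < norm h" if "R \<le> norm h" for h :: "real^'n"
      using that R\<^sub>0(1) xy norm_triangle_ineq4[of x "x - y"] unfolding R_def by simp_all
    have "I - J \<le> unit_ball_vol CARD('n) * CARD('n) * (E * (2 + 2 * d + k * d) * R + 2 * (1 + d) * \<tau>)"
      unfolding d_def
    proof (rule space_max_pv_diff_le[OF df(1)[OF t] dg(1)[OF t] Lf[OF sub[OF t]] Lg[OF sub[OF t]] E0 _ _ _ I(1) J(1)])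
      show "k \<ge> 0" using k by simp
      show "(2 * real (CARD('n) + 1) - 1) * (L + 2 * E)\<^sup>2 \<le> 1"
        using small[OF E0 Es] by (simp add: d_def)
      show "f t (x + h) - g t (y + h') - k * (norm (x + h - (y + h')))\<^sup>2 - E * bracket (x + h)
          \<le> f t x - g t y - k * (norm (x - y))\<^sup>2 - E * bracket x" for h h'
        using max[OF t, of "x + h" "y + h'"] by (simp add: \<Phi>_def E_def mult.assoc)
      show "\<bar>f t (x + h) - f t x\<bar> \<le> N (norm h)" if h: "R \<le> norm h" for h
      proof -
        have "norm (x + h) < 2 * norm h" "norm x < 2 * norm h"
          using far[OF h] norm_triangle_ineq[of x h] norm_ge_zero[of h] by linarith+
        from Nf(3)[OF t this(1)] Nf(3)[OF t this(2)] show ?thesis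
          using Ng(2)[of "norm h"] by (simp add: N_def abs_le_iff)
      qed
      show "\<bar>g t (y + h) - g t y\<bar> \<le> N (norm h)" if h: "R \<le> norm h" for h
      proof -
        have "norm (y + h) < 2 * norm h" "norm y < 2 * norm h"
          using far[OF h] norm_triangle_ineq[of y h] norm_ge_zero[of h] by linarith+
        from Ng(3)[OF t this(1)] Ng(3)[OF t this(2)] show ?thesis
          using Nf(2)[of "norm h"] by (simp add: N_def abs_le_iff)
      qed
      show "(\<integral>\<^sup>+r. ennreal (N r / r\<^sup>2) * indicator {R..} r \<partial>lborel) \<le> ennreal \<tau>"
        by (rule R\<^sub>0(2)[OF R(2)])
    qed (use N0 R \<tau> in auto)
    also have "\<dots> = c * (E * (2 + 2 * d + k * d) * R) + c * (2 * (1 + d) * \<tau>)"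
      by (simp add: c_def distrib_left)
    also have "c * (2 * (1 + d) * \<tau>) = (4 * (1 + d) * c * \<tau>) / 2"
      by (simp add: algebra_simps)
    also have "4 * (1 + d) * c * \<tau> = \<kappa>"
    proof -
      have "4 * (1 + d) * c \<noteq> 0"
        using c d by simp
      then show ?thesis
        unfolding \<tau>_def by (simp only: times_divide_eq_right nonzero_mult_div_cancel_left not_False_eq_True)
    qed
    also have "c * (E * (2 + 2 * d + k * d) * R) \<le> \<mu> * (E * bracket x)"
    proof -
      have "R \<le> (R\<^sub>0 + 3) * bracket x"
        using bracket_ge_norm[of x] mult_left_mono[OF bracket_ge_1[of x], of "R\<^sub>0 + 2"] R\<^sub>0(1)
        by (simp add: R_def algebra_simps)
      then have "c * (E * (2 + 2 * d + k * d)) * R \<le> c * (E * (2 + 2 * d + k * d)) * ((R\<^sub>0 + 3) * bracket x)"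
        using c E0 d k by (intro mult_left_mono) auto
      then show ?thesis
        by (simp only: \<mu>_def mult_ac)
    qed
    finally have IJ: "I - J \<le> \<mu> * (E * bracket x) + \<kappa> / 2" by simp
    \<comment> \<open>The penalty grows in time at rate
      \<open>\<mu> * (E * bracket x) + \<kappa>\<close>, which exceeds the bound on
      \<open>I - J\<close> by \<open>\<kappa> / 2\<close>; this contradicts the sub- and
      supersolution inequalities.\<close>
    have "deriv (\<lambda>s. f s x) t - deriv (\<lambda>s. g s y) t - \<mu> * (E * bracket x) - \<kappa> \<ge> 0"
    proof (rule DERIV_nonneg_at_right_max[OF _ ta])
      show "((\<lambda>s. \<Phi> (s, x, y)) has_real_derivative
          deriv (\<lambda>s. f s x) t - deriv (\<lambda>s. g s y) t - \<mu> * (E * bracket x) - \<kappa>) (at t)"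
        unfolding \<Phi>_def prod.case E_def
        by (rule derivative_eq_intros df(2)[OF t] dg(2)[OF t] refl | simp)+
      show "\<Phi> (s, x, y) \<le> \<Phi> (t, x, y)" if "a \<le> s" "s \<le> t" for s
        using that t by (intro max) auto
    qed
    with IJ I(2) J(2) \<kappa> show False by linarith
  qed
  show thesis
  proof (rule that)
    show "\<epsilon>\<^sub>0 > 0" using s by (simp add: \<epsilon>\<^sub>0_def)
    fix \<epsilon> t x assume "0 < \<epsilon>" "\<epsilon> < \<epsilon>\<^sub>0" "t \<in> {a..b}"
    \<comment> \<open>On the diagonal the quadratic penalty vanishes.\<close>
    from main[OF this, of x x]
    show "f t x \<le> g t x + \<eta> + 1 / k + \<kappa> * (t - a) + \<epsilon> * (exp (\<mu> * (t - a)) * bracket x)"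
      by simp
  qed
qed

section \<open>Removal of the penalties and passage to the end times\<close>

lemma slab_comparison:
  fixes f g :: "real \<Rightarrow> real^'n \<Rightarrow> real"
  defines "d \<equiv> real (CARD('n) + 1)"
  assumes f: "muskat_classical (\<le>) T f" and g: "muskat_classical (\<ge>) T g"
    and Lf: "\<And>t x. t \<in> {0<..<T} \<Longrightarrow> norm (grad (f t) x) \<le> L"
    and Lg: "\<And>t x. t \<in> {0<..<T} \<Longrightarrow> norm (grad (g t) x) \<le> L"
    and L: "L < 1 / sqrt (2 * d - 1)"
    and ab: "0 < a" "a \<le> b" "b < T"
    and init: "\<And>x. f a x \<le> g a x + \<eta>" and t: "t \<in> {a..b}"
  shows "f t x \<le> g t x + \<eta>"
\<comment> \<open>Three nested limits, with \<open>\<delta>\<close> in the role of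
  \<open>1 / k\<close>. The limit in \<open>\<epsilon>\<close> is innermost because
  \<open>\<mu>\<close> and \<open>\<epsilon>\<^sub>0\<close> depend on \<open>k\<close> and
  \<open>\<kappa>\<close>.\<close>
proof (rule le_of_small_multiples[of 1 1])
  fix \<delta> :: real assume \<delta>: "0 < \<delta>" "\<delta> < 1"
  show "f t x \<le> g t x + \<eta> + \<delta> * 1"
  proof (rule le_of_small_multiples[of "t - a" 1])
    show "t - a \<ge> 0" using t by simp
    fix \<kappa> :: real assume \<kappa>: "0 < \<kappa>"
    have k: "1 / \<delta> \<ge> 1"
      using \<delta> by simp
    obtain \<mu> \<epsilon>\<^sub>0 where \<epsilon>\<^sub>0: "\<epsilon>\<^sub>0 > 0"
      and le: "\<And>\<epsilon> t x. 0 < \<epsilon> \<Longrightarrow> \<epsilon> < \<epsilon>\<^sub>0 \<Longrightarrow> t \<in> {a..b} \<Longrightarrow>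
        f t x \<le> g t x + \<eta> + 1 / (1 / \<delta>) + \<kappa> * (t - a) + \<epsilon> * (exp (\<mu> * (t - a)) * bracket x)"
      by (rule penalised_comparison[OF f g Lf Lg L[unfolded d_def] ab init k \<kappa>]) (assumption, assumption, rule that)
    show "f t x \<le> g t x + \<eta> + \<delta> * 1 + \<kappa> * (t - a)"
    proof (rule le_of_small_multiples[OF _ \<epsilon>\<^sub>0])
      show "exp (\<mu> * (t - a)) * bracket x \<ge> 0"
        using bracket_ge_1[of x] by simp
      show "f t x \<le> g t x + \<eta> + \<delta> * 1 + \<kappa> * (t - a) + \<epsilon> * (exp (\<mu> * (t - a)) * bracket x)"
        if "0 < \<epsilon>" "\<epsilon> < \<epsilon>\<^sub>0" for \<epsilon>
        using le[OF that t, of x] by simp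
    qed
  qed simp
qed simp_all

lemma norm_le_of_sup_norm_on_less:
  assumes "sup_norm_on S u < ereal c" "z \<in> S"
  shows "norm (u z) \<le> c"
proof -
  have "ereal (norm (u z)) \<le> sup_norm_on S u"
    unfolding sup_norm_on_def using assms(2) by (rule SUP_upper)
  also note assms(1)
  finally show ?thesis by simp
qed

lemma muskat_classical_uniform_limits:
  assumes f: "muskat_classical rel T f" and e: "e > 0"
  shows "\<forall>\<^sub>F s in at_right 0. \<forall>x. \<bar>f s x - f 0 x\<bar> \<le> e"
    and "\<forall>\<^sub>F s in at_right 0. \<forall>x. \<bar>f T x - f (T - s) x\<bar> \<le> e"
proof -
  have "((\<lambda>s. sup_norm_on UNIV (\<lambda>x. f s x - f 0 x)) \<longlongrightarrow> 0) (at_right 0)"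
    and "((\<lambda>s. sup_norm_on UNIV (\<lambda>x. f T x - f (T - s) x)) \<longlongrightarrow> 0) (at_right 0)"
    using f unfolding muskat_classical_def by blast+
  from order_tendstoD(2)[OF this(1), of "ereal e"] order_tendstoD(2)[OF this(2), of "ereal e"] e
  have "\<forall>\<^sub>F s in at_right 0. sup_norm_on UNIV (\<lambda>x. f s x - f 0 x) < ereal e"
    and "\<forall>\<^sub>F s in at_right 0. sup_norm_on UNIV (\<lambda>x. f T x - f (T - s) x) < ereal e"
    by simp_all
  then show "\<forall>\<^sub>F s in at_right 0. \<forall>x. \<bar>f s x - f 0 x\<bar> \<le> e"
    and "\<forall>\<^sub>F s in at_right 0. \<forall>x. \<bar>f T x - f (T - s) x\<bar> \<le> e"
    by (eventually_elim, use norm_le_of_sup_norm_on_less[OF _ UNIV_I] in fastforce)+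
qed

theorem theorem7p1:
  fixes d :: nat and T :: real
    and f g :: "real \<Rightarrow> real^'n \<Rightarrow> real"
  assumes "CARD('n) = d - 1" and "d = 2 \<or> d = 3" and "T > 0"
    and "classical_muskat_subsolution T f"
    and "classical_muskat_supersolution T g"
    and "sup_norm_on ({0<..<T} \<times> UNIV) (\<lambda>(t, x). grad (f t) x) < ereal (1 / sqrt (2 * real d - 1))"
    and "sup_norm_on ({0<..<T} \<times> UNIV) (\<lambda>(t, x). grad (g t) x) < ereal (1 / sqrt (2 * real d - 1))"
    and "\<forall>x. f 0 x \<le> g 0 x"
  shows "\<forall>t\<in>{0..T}. \<forall>x. f t x \<le> g t x"
proof (intro ballI allI)
  have f: "muskat_classical (\<le>) T f" and g: "muskat_classical (\<ge>) T g"
    using assms(4,5) by (simp_all add: classical_muskat_subsolution_def classical_muskat_supersolution_def)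
  have d: "real (CARD('n) + 1) = real d"
    using assms(1,2) by auto
  \<comment> \<open>Strictness of both slope bounds leaves room for one real \<open>L\<close>
    strictly between the larger supremum and the threshold.\<close>
  have "max (sup_norm_on ({0<..<T} \<times> UNIV) (\<lambda>(t, x). grad (f t) x))
      (sup_norm_on ({0<..<T} \<times> UNIV) (\<lambda>(t, x). grad (g t) x)) < ereal (1 / sqrt (2 * real d - 1))"
    using assms(6,7) by simp
  then obtain L where L: "L < 1 / sqrt (2 * real (CARD('n) + 1) - 1)"
      "sup_norm_on ({0<..<T} \<times> UNIV) (\<lambda>(t, x). grad (f t) x) < ereal L"
      "sup_norm_on ({0<..<T} \<times> UNIV) (\<lambda>(t, x). grad (g t) x) < ereal L"
    unfolding d by (elim ereal_dense2[THEN exE]) auto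
  have Lf: "norm (grad (f t) x) \<le> L" and Lg: "norm (grad (g t) x) \<le> L" if "t \<in> {0<..<T}" for t x
    using norm_le_of_sup_norm_on_less[OF L(2), of "(t, x)"] norm_le_of_sup_norm_on_less[OF L(3), of "(t, x)"] that
    by auto
  \<comment> \<open>The slab starts at a small time \<open>a\<close>, where uniform convergence to
    the initial data gives the ordering up to \<open>2 e\<close>, one \<open>e\<close> per function,
    and ends at \<open>t\<close> itself.\<close>
  have interior: "f t x \<le> g t x" if t: "0 < t" "t < T" for t x
  proof (rule le_of_small_multiples[of 2 1])
    fix e :: real assume e: "0 < e"
    have "\<forall>\<^sub>F s in at_right 0. s \<in> {0<..<t}"
      using t(1) by (rule eventually_at_right_real)
    from eventually_conj[OF this eventually_conj[OF muskat_classical_uniform_limits(1)[OF f e]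
        muskat_classical_uniform_limits(1)[OF g e]]]
    obtain a where a: "0 < a" "a < t" "\<And>x. \<bar>f a x - f 0 x\<bar> \<le> e" "\<And>x. \<bar>g a x - g 0 x\<bar> \<le> e"
      using eventually_happens'[of "at_right (0::real)"] trivial_limit_at_right_real[of 0]
      by (metis (no_types, lifting) greaterThanLessThan_iff)
    have init: "f a z \<le> g a z + e * 2" for z
      using a(3)[of z] a(4)[of z] assms(8)[rule_format, of z] by linarith
    show "f t x \<le> g t x + e * 2"
      by (rule slab_comparison[OF f g Lf Lg L(1) a(1) less_imp_le[OF a(2)] t(2) init]) (use a in simp_all)
  qed simp_all
  fix t x assume "t \<in> {0..T}"
  then consider "t = 0" | "0 < t" "t < T" | "t = T"
    by fastforce
  then show "f t x \<le> g t x"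
  proof cases
    case 3
    show ?thesis
    \<comment> \<open>The final time lies outside the open strip, so the ordering is carried over
      from \<open>T - s\<close> by uniform convergence, again with an error of
      \<open>2 e\<close>.\<close>
    proof (rule le_of_small_multiples[of 2 1])
      fix e :: real assume e: "0 < e"
      have "\<forall>\<^sub>F s in at_right 0. s \<in> {0<..<T}"
        using assms(3) by (rule eventually_at_right_real)
      from eventually_conj[OF this eventually_conj[OF muskat_classical_uniform_limits(2)[OF f e]
          muskat_classical_uniform_limits(2)[OF g e]]]
      obtain s where s: "0 < s" "s < T" "\<bar>f T x - f (T - s) x\<bar> \<le> e" "\<bar>g T x - g (T - s) x\<bar> \<le> e"
        using eventually_happens'[of "at_right (0::real)"] trivial_limit_at_right_real[of 0]
        by (metis (no_types, lifting) greaterThanLessThan_iff)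
      show "f t x \<le> g t x + e * 2"
        using s interior[of "T - s" x] 3 by auto
    qed simp_all
  qed (use assms(8) interior in auto)
qed

end
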